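(* Let $\mathbf{L}$ be an invertible $(D\times D)$ MDO with causal Green's matrix $\mathbf{G}_{\mathbf{L}}$, and let $(\mathbf{p},\boldsymbol{\phi})$ be an $\mathbf{L}$-admissible system with associated space $\mathcal{C}_{\mathbf{L}}(\mathbb{R},\mathbb{R}^D)$. If $\boldsymbol{\rho}\in\mathcal{D}'(\mathbb{R},\mathbb{R}^D)$ is a compactly supported distribution such that the vector-valued distribution $\mathbf{v}=\mathbf{G}_{\mathbf{L}}^{\star}\ast\boldsymbol{\rho}$ is representable by a continuous function $\mathbf{v}\in\mathcal{C}(\mathbb{R},\mathbb{R}^D)$, then $\boldsymbol{\rho}\in\mathcal{C}_{\mathbf{L}}(\mathbb{R},\mathbb{R}^D)$.
   Context: An ordinary differential operator (ODO) is $\sum_{n}a_n\mathrm{D}^n$ (finite sum, real constants $a_n$) acting on $\mathcal{D}'(\mathbb{R})$. A $(D\times D)$ MDO is a matrix $\mathbf{L}=(\mathrm{L}_{r,c})$ of ODOs acting by $[\mathbf{L}\{\mathbf{f}\}]_r=\sum_d\mathrm{L}_{r,d}\{f_d\}$ (column by column on matrices). Its determinant is the ODO obtained from the Leibniz formula with products replaced by compositions; $\mathbf{L}$ is invertible if $\det(\mathbf{L})\neq0$. The adjoint has entries $[\mathbf{L}^\star]_{r,c}=\mathrm{L}_{c,r}^\star$, $(\mathrm{D}^n)^\star=(-1)^n\mathrm{D}^n$. For an invertible MDO, $\mathbf{G}_{\mathbf{L}}$ is its unique causal (supported in $[0,\infty)$) Green's matrix: $\mathbf{G}_{\mathbf{L}}\in\mathcal{D}'(\mathbb{R},\mathbb{R}^{D\times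 D})$, $\mathbf{L}\{\mathbf{G}_{\mathbf{L}}\}=\mathbf{I}\delta$; and $\mathbf{G}_{\mathbf{L}}^\star(\cdot)=\mathbf{G}_{\mathbf{L}}^{\intercal}(-\cdot)$. Convolution is $[\mathbf{G}\ast\boldsymbol{\rho}]_d=\sum_{d'}\mathrm{G}_{d,d'}\ast\rho_{d'}$. The null space is $\mathcal{N}_{\mathbf{L}}=\{\mathbf{q}\in\mathcal{D}'(\mathbb{R},\mathbb{R}^D):\mathbf{L}\{\mathbf{q}\}=\mathbf{0}\}$, of finite dimension $N$. An $\mathbf{L}$-admissible system $(\mathbf{p},\boldsymbol{\phi})$ consists of a basis $(\mathbf{p}_n)_{n=1}^N$ of $\mathcal{N}_{\mathbf{L}}$ and smooth compactly supported functions $\boldsymbol{\phi}_n\in\mathcal{D}(\mathbb{R},\mathbb{R}^D)$ with $\langle\mathbf{p}_n,\boldsymbol{\phi}_m\rangle=\delta_{m,n}$ and all components supported in $[0,\phi^+]$ for a common $\phi^+\ge0$. With $\mathcal{C}_0(\mathbb{R},\mathbb{R}^D)$ the continuous functions vanishing at infinity, $$\mathcal{C}_{\mathbf{L}}(\mathbb{R},\mathbb{R}^D)=\Big\{\mathbf{L}^\star\{\mathbf{v}\}+\sum_{n=1}^Na_n\boldsymbol{\phi}_n:\ \mathbf{v}\in\mathcal{C}_0(\mathbb{R},\mathbb{R}^D),\ (a_n)_{n=1}^N\in\mathbb{R}^N\Big\}.$$ *)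

theory Defs
  imports "HOL-Analysis.Analysis" "HOL-Computational_Algebra.Polynomial"
begin

section \<open>Test functions on the real line\<close>

definition smooth :: "(real \<Rightarrow> real) \<Rightarrow> bool" where
  "smooth f \<longleftrightarrow> (\<forall>k x. (deriv ^^ k) f differentiable (at x))"

definition fun_support :: "(real \<Rightarrow> real) \<Rightarrow> real set" where
  "fun_support f = closure {x. f x \<noteq> 0}"

lemma smooth_DERIV:
  assumes "smooth f"
  shows "((deriv ^^ k) f has_real_derivative (deriv ^^ Suc k) f x) (at x)"
  using assms by (simp add: smooth_def DERIV_deriv_iff_real_differentiable)

lemma smooth_chainI:
  assumes "\<And>x. F 0 x = f x"
    and "\<And>k x. (F k has_real_derivative F (Suc k) x) (at x)"
  shows "smooth f" and "(deriv ^^ k) f = F k"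
proof -
  have *: "(deriv ^^ k) f = F k" for k
  proof (induction k)
    case 0
    then show ?case using assms(1) by (simp add: fun_eq_iff)
  next
    case (Suc k)
    then show ?case by (auto intro!: DERIV_imp_deriv assms(2))
  qed
  then show "(deriv ^^ k) f = F k" .
  show "smooth f"
    unfolding smooth_def * using assms(2) real_differentiable_def by blast
qed

lemma smooth_zero: "smooth (\<lambda>x. 0)"
  by (rule smooth_chainI(1)[where F = "\<lambda>k x. 0"]) auto

lemma fun_support_leI:
  assumes "\<And>x. f x \<noteq> 0 \<Longrightarrow> x \<in> K" "closed K"
  shows "fun_support f \<subseteq> K"
  unfolding fun_support_def using assms by (intro closure_minimal) auto

lemma fun_support_in: "f x \<noteq> 0 \<Longrightarrow> x \<in> fun_support f"
  unfolding fun_support_def using closure_subset[of "{x. f x \<noteq> 0}"] by blast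

lemma closed_fun_support: "closed (fun_support f)"
  unfolding fun_support_def by simp

lemma compact_fun_supportI:
  assumes "\<And>x. f x \<noteq> 0 \<Longrightarrow> x \<in> K" "compact K"
  shows "compact (fun_support f)"
proof -
  have "fun_support f \<subseteq> K"
    by (rule fun_support_leI[OF assms(1) compact_imp_closed[OF assms(2)]])
  then show ?thesis
    using compact_Int_closed[OF assms(2) closed_fun_support, of f] by (simp add: Int_absorb1)
qed

lemma compact_real_subset_interval:
  fixes K :: "real set"
  assumes "compact K"
  obtains r where "0 < r" "K \<subseteq> {- r..r}"
proof -
  obtain b where b: "0 < b" "\<forall>x\<in>K. norm x \<le> b"
    using compact_imp_bounded[OF assms] unfolding bounded_pos by blast
  have "K \<subseteq> {- b..b}" using b(2) by (auto simp: abs_le_iff)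
  with b(1) show ?thesis by (rule that)
qed

typedef test_fun = "{f :: real \<Rightarrow> real. smooth f \<and> compact (fun_support f)}"
  morphisms tf_apply Abs_test_fun
proof -
  show ?thesis by (rule exI[of _ "\<lambda>x. 0"]) (simp add: smooth_zero fun_support_def)
qed

setup_lifting type_definition_test_fun

abbreviation tf_support :: "test_fun \<Rightarrow> real set" where
  "tf_support \<phi> \<equiv> fun_support (tf_apply \<phi>)"

lemma tf_smooth: "smooth (tf_apply \<phi>)" and tf_compact: "compact (tf_support \<phi>)"
  using tf_apply[of \<phi>] by auto

lemma tf_eqI: "(\<And>x. tf_apply \<phi> x = tf_apply \<psi> x) \<Longrightarrow> \<phi> = \<psi>"
  by (simp add: tf_apply_inject[symmetric] fun_eq_iff)

lemma smooth_add:
  assumes "smooth f" "smooth g"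
  shows "smooth (\<lambda>x. f x + g x)"
    and "(deriv ^^ k) (\<lambda>x. f x + g x) = (\<lambda>x. (deriv ^^ k) f x + (deriv ^^ k) g x)"
proof -
  let ?F = "\<lambda>k x. (deriv ^^ k) f x + (deriv ^^ k) g x"
  have "(?F k has_real_derivative ?F (Suc k) x) (at x)" for k x
    using assms by (intro DERIV_add smooth_DERIV)
  from smooth_chainI[of ?F, OF _ this]
  show "smooth (\<lambda>x. f x + g x)" "(deriv ^^ k) (\<lambda>x. f x + g x) = ?F k" by auto
qed

lemma smooth_cmult:
  assumes "smooth f"
  shows "smooth (\<lambda>x. c * f x)"
    and "(deriv ^^ k) (\<lambda>x. c * f x) = (\<lambda>x. c * (deriv ^^ k) f x)"
proof -
  let ?F = "\<lambda>k x. c * (deriv ^^ k) f x"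
  have "(?F k has_real_derivative ?F (Suc k) x) (at x)" for k x
    using assms by (intro DERIV_cmult smooth_DERIV)
  from smooth_chainI[of ?F, OF _ this]
  show "smooth (\<lambda>x. c * f x)" "(deriv ^^ k) (\<lambda>x. c * f x) = ?F k" by auto
qed

lemma smooth_shift:
  assumes "smooth f"
  shows "smooth (\<lambda>x. f (a + x))"
    and "(deriv ^^ k) (\<lambda>x. f (a + x)) = (\<lambda>x. (deriv ^^ k) f (a + x))"
proof -
  let ?F = "\<lambda>k x. (deriv ^^ k) f (a + x)"
  have "(?F k has_real_derivative ?F (Suc k) x) (at x)" for k x
    using smooth_DERIV[OF assms, of k "a + x"]
    by (subst (asm) add.commute, subst (asm) DERIV_shift) (simp add: add.commute)
  from smooth_chainI[of ?F, OF _ this]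
  show "smooth (\<lambda>x. f (a + x))" "(deriv ^^ k) (\<lambda>x. f (a + x)) = ?F k" by auto
qed

lemma smooth_reflect:
  assumes "smooth f"
  shows "smooth (\<lambda>x. f (- x))"
    and "(deriv ^^ k) (\<lambda>x. f (- x)) = (\<lambda>x. (- 1) ^ k * (deriv ^^ k) f (- x))"
proof -
  let ?F = "\<lambda>k x. (- 1) ^ k * (deriv ^^ k) f (- x)"
  have "(?F k has_real_derivative ?F (Suc k) x) (at x)" for k x
  proof -
    have "((\<lambda>x. (deriv ^^ k) f (- x)) has_real_derivative (deriv ^^ Suc k) f (- x) * (- 1)) (at x)"
      by (rule DERIV_chain2[OF smooth_DERIV[OF assms]]) (auto intro!: derivative_eq_intros)
    from DERIV_cmult[OF this, of "(- 1) ^ k"] show ?thesis by simp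
  qed
  from smooth_chainI[of ?F, OF _ this]
  show "smooth (\<lambda>x. f (- x))" "(deriv ^^ k) (\<lambda>x. f (- x)) = ?F k" by auto
qed

lemma smooth_deriv:
  assumes "smooth f"
  shows "smooth (deriv f)" and "(deriv ^^ k) (deriv f) = (deriv ^^ Suc k) f"
proof -
  show *: "(deriv ^^ k) (deriv f) = (deriv ^^ Suc k) f" for k
    by (simp add: funpow_swap1)
  show "smooth (deriv f)"
    using assms[unfolded smooth_def, rule_format, of "Suc k" for k]
    unfolding smooth_def * by blast
qed

lemma deriv_zero_off_support:
  assumes "x \<notin> fun_support f"
  shows "(deriv ^^ k) f x = 0"
proof -
  have "open (- fun_support f)" using closed_fun_support by (simp add: open_Compl)
  then have "eventually (\<lambda>y. y \<in> - fun_support f) (nhds x)"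
    using assms by (intro eventually_nhds_in_open) auto
  then have "eventually (\<lambda>y. f y = 0) (nhds x)"
    by eventually_elim (use fun_support_in[of f] in blast)
  then have "(deriv ^^ k) f x = (deriv ^^ k) (\<lambda>_. 0) x"
    by (rule higher_deriv_cong_ev) simp
  also have "(deriv ^^ k) (\<lambda>_::real. 0 :: real) = (\<lambda>_. 0)"
    by (rule smooth_chainI(2)[where F = "\<lambda>k x. 0"]) auto
  finally show ?thesis by simp
qed

instantiation test_fun :: real_vector
begin

lift_definition zero_test_fun :: test_fun is "\<lambda>x. 0"
  by (simp add: smooth_zero fun_support_def)

lift_definition plus_test_fun :: "test_fun \<Rightarrow> test_fun \<Rightarrow> test_fun" is "\<lambda>f g x. f x + g x"
proof -
  fix f g :: "real \<Rightarrow> real"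
  assume *: "smooth f \<and> compact (fun_support f)" "smooth g \<and> compact (fun_support g)"
  have "compact (fun_support (\<lambda>x. f x + g x))"
  proof (rule compact_fun_supportI)
    show "compact (fun_support f \<union> fun_support g)" using * by auto
    show "x \<in> fun_support f \<union> fun_support g" if "f x + g x \<noteq> 0" for x
      using that fun_support_in[of f x] fun_support_in[of g x] by (cases "f x = 0") auto
  qed
  then show "smooth (\<lambda>x. f x + g x) \<and> compact (fun_support (\<lambda>x. f x + g x))"
    using * smooth_add(1) by blast
qed

lift_definition scaleR_test_fun :: "real \<Rightarrow> test_fun \<Rightarrow> test_fun" is "\<lambda>c f x. c * f x"
proof -
  fix c :: real and f :: "real \<Rightarrow> real"
  assume *: "smooth f \<and> compact (fun_support f)"
  have "compact (fun_support (\<lambda>x. c * f x))"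
    by (rule compact_fun_supportI[where K = "fun_support f"]) (use * fun_support_in in auto)
  then show "smooth (\<lambda>x. c * f x) \<and> compact (fun_support (\<lambda>x. c * f x))"
    using * smooth_cmult(1) by blast
qed

definition uminus_test_fun :: "test_fun \<Rightarrow> test_fun" where
  "uminus_test_fun \<phi> = (- 1) *\<^sub>R \<phi>"

definition minus_test_fun :: "test_fun \<Rightarrow> test_fun \<Rightarrow> test_fun" where
  "minus_test_fun \<phi> \<psi> = \<phi> + (- 1) *\<^sub>R \<psi>"

instance
  by standard
    (auto simp: uminus_test_fun_def minus_test_fun_def plus_test_fun.rep_eq zero_test_fun.rep_eq
      scaleR_test_fun.rep_eq algebra_simps intro!: tf_eqI)

end

lift_definition tf_deriv :: "test_fun \<Rightarrow> test_fun" is deriv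
proof -
  fix f :: "real \<Rightarrow> real"
  assume *: "smooth f \<and> compact (fun_support f)"
  have "compact (fun_support (deriv f))"
    by (rule compact_fun_supportI[where K = "fun_support f"])
      (use * deriv_zero_off_support[of _ f 1] in auto)
  then show "smooth (deriv f) \<and> compact (fun_support (deriv f))"
    using * smooth_deriv(1) by blast
qed

lift_definition tf_shift :: "real \<Rightarrow> test_fun \<Rightarrow> test_fun" is "\<lambda>a f x. f (a + x)"
proof -
  fix a :: real and f :: "real \<Rightarrow> real"
  assume *: "smooth f \<and> compact (fun_support f)"
  have "compact (fun_support (\<lambda>x. f (a + x)))"
  proof (rule compact_fun_supportI)
    show "compact ((\<lambda>y. y - a) ` fun_support f)"
      using * by (auto intro!: compact_continuous_image continuous_intros)
    show "x \<in> (\<lambda>y. y - a) ` fun_support f" if "f (a + x) \<noteq> 0" for x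
      using that fun_support_in[of f "a + x"] by (intro image_eqI[of _ _ "a + x"]) auto
  qed
  then show "smooth (\<lambda>x. f (a + x)) \<and> compact (fun_support (\<lambda>x. f (a + x)))"
    using * smooth_shift(1) by blast
qed

lift_definition tf_reflect :: "test_fun \<Rightarrow> test_fun" is "\<lambda>f x. f (- x)"
proof -
  fix f :: "real \<Rightarrow> real"
  assume *: "smooth f \<and> compact (fun_support f)"
  have "compact (fun_support (\<lambda>x. f (- x)))"
  proof (rule compact_fun_supportI)
    show "compact (uminus ` fun_support f)"
      using * by (auto intro!: compact_continuous_image continuous_intros)
    show "x \<in> uminus ` fun_support f" if "f (- x) \<noteq> 0" for x
      using that fun_support_in[of f "- x"] by (intro image_eqI[of _ _ "- x"]) auto
  qed
  then show "smooth (\<lambda>x. f (- x)) \<and> compact (fun_support (\<lambda>x. f (- x)))"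
    using * smooth_reflect(1) by blast
qed

lemmas tf_rep_eqs = plus_test_fun.rep_eq zero_test_fun.rep_eq scaleR_test_fun.rep_eq
  tf_deriv.rep_eq tf_shift.rep_eq tf_reflect.rep_eq

definition tf_seminorm :: "nat \<Rightarrow> test_fun \<Rightarrow> real" where
  "tf_seminorm k \<phi> = (SUP x. \<bar>(deriv ^^ k) (tf_apply \<phi>) x\<bar>)"

lemma tf_continuous_on: "continuous_on UNIV ((deriv ^^ k) (tf_apply \<phi>))"
  by (intro continuous_at_imp_continuous_on ballI DERIV_isCont[OF smooth_DERIV[OF tf_smooth]])

lemma tf_deriv_bounded: "bdd_above (range (\<lambda>x. \<bar>(deriv ^^ k) (tf_apply \<phi>) x\<bar>))"
proof -
  let ?g = "(deriv ^^ k) (tf_apply \<phi>)"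
  have "compact (?g ` tf_support \<phi>)"
    by (rule compact_continuous_image[OF continuous_on_subset[OF tf_continuous_on subset_UNIV] tf_compact])
  then obtain b where b: "\<forall>y\<in>?g ` tf_support \<phi>. norm y \<le> b"
    using compact_imp_bounded[THEN bounded_iff[THEN iffD1]] by blast
  have "\<bar>?g x\<bar> \<le> max b 0" for x
  proof (cases "x \<in> tf_support \<phi>")
    case True
    then have "norm (?g x) \<le> b" using b by blast
    then show ?thesis by simp
  qed (simp add: deriv_zero_off_support)
  then show ?thesis by (intro bdd_aboveI2)
qed

lemma tf_seminorm_upper: "\<bar>(deriv ^^ k) (tf_apply \<phi>) x\<bar> \<le> tf_seminorm k \<phi>"
  unfolding tf_seminorm_def by (rule cSUP_upper[OF _ tf_deriv_bounded]) simp

lemma tf_seminorm_least: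
  "(\<And>x. \<bar>(deriv ^^ k) (tf_apply \<phi>) x\<bar> \<le> M) \<Longrightarrow> tf_seminorm k \<phi> \<le> M"
  unfolding tf_seminorm_def by (rule cSUP_least) simp_all

lemma tf_seminorm_nonneg: "0 \<le> tf_seminorm k \<phi>"
  using tf_seminorm_upper[of k \<phi> 0] by linarith

lemma higher_deriv_tf_add:
  "(deriv ^^ k) (tf_apply (\<phi> + \<psi>)) x = (deriv ^^ k) (tf_apply \<phi>) x + (deriv ^^ k) (tf_apply \<psi>) x"
  by (simp only: tf_rep_eqs smooth_add(2)[OF tf_smooth tf_smooth])

lemma higher_deriv_tf_scaleR:
  "(deriv ^^ k) (tf_apply (c *\<^sub>R \<phi>)) x = c * (deriv ^^ k) (tf_apply \<phi>) x"
  by (simp only: tf_rep_eqs smooth_cmult(2)[OF tf_smooth])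

lemma higher_deriv_tf_diff:
  "(deriv ^^ k) (tf_apply (\<phi> - \<psi>)) x = (deriv ^^ k) (tf_apply \<phi>) x - (deriv ^^ k) (tf_apply \<psi>) x"
  unfolding minus_test_fun_def higher_deriv_tf_add higher_deriv_tf_scaleR by simp

lemma higher_deriv_tf_deriv: "(deriv ^^ k) (tf_apply (tf_deriv \<phi>)) = (deriv ^^ Suc k) (tf_apply \<phi>)"
  unfolding tf_deriv.rep_eq by (rule smooth_deriv(2)[OF tf_smooth])

lemma higher_deriv_tf_shift:
  "(deriv ^^ k) (tf_apply (tf_shift a \<phi>)) x = (deriv ^^ k) (tf_apply \<phi>) (a + x)"
  by (simp only: tf_rep_eqs smooth_shift(2)[OF tf_smooth])

lemma tf_apply_deriv_pow: "tf_apply ((tf_deriv ^^ k) \<phi>) = (deriv ^^ k) (tf_apply \<phi>)"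
  by (induction k) (auto simp: tf_rep_eqs)

lemma tf_seminorm_deriv: "tf_seminorm k ((tf_deriv ^^ j) \<phi>) = tf_seminorm (k + j) \<phi>"
  by (simp add: tf_seminorm_def tf_apply_deriv_pow funpow_add)

lemma tf_seminorm_shift: "tf_seminorm k (tf_shift a \<phi>) \<le> tf_seminorm k \<phi>"
  by (rule tf_seminorm_least) (simp add: higher_deriv_tf_shift tf_seminorm_upper)

lemma tf_seminorm_reflect: "tf_seminorm k (tf_reflect \<phi>) \<le> tf_seminorm k \<phi>"
proof (rule tf_seminorm_least)
  fix x
  have "\<bar>(- 1 :: real) ^ k\<bar> = 1" by (simp add: power_abs)
  then show "\<bar>(deriv ^^ k) (tf_apply (tf_reflect \<phi>)) x\<bar> \<le> tf_seminorm k \<phi>"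
    by (simp add: tf_rep_eqs smooth_reflect(2)[OF tf_smooth] abs_mult tf_seminorm_upper)
qed

lemma tf_support_deriv: "tf_support (tf_deriv \<phi>) \<subseteq> tf_support \<phi>"
  using deriv_zero_off_support[of _ "tf_apply \<phi>" 1]
  by (intro fun_support_leI closed_fun_support) (auto simp: tf_rep_eqs)

lemma tf_support_deriv_pow: "tf_support ((tf_deriv ^^ k) \<phi>) \<subseteq> tf_support \<phi>"
proof (induction k)
  case (Suc k)
  then show ?case using tf_support_deriv[of "(tf_deriv ^^ k) \<phi>"] by simp
qed simp

lemma tf_support_shift:
  assumes "tf_support \<phi> \<subseteq> {a..b}"
  shows "tf_support (tf_shift x \<phi>) \<subseteq> {a - x..b - x}"
proof (rule fun_support_leI)
  fix y assume "tf_apply (tf_shift x \<phi>) y \<noteq> 0"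
  then have "x + y \<in> {a..b}" using assms fun_support_in[of "tf_apply \<phi>" "x + y"]
    by (auto simp: tf_rep_eqs)
  then show "y \<in> {a - x..b - x}" by auto
qed simp

lemma tf_shift_linear: "linear (tf_shift a)"
  by (rule linearI) (auto intro!: tf_eqI simp: tf_rep_eqs)

lemma tf_reflect_linear: "linear tf_reflect"
  by (rule linearI) (auto intro!: tf_eqI simp: tf_rep_eqs)

lemma tf_deriv_linear: "linear tf_deriv"
proof (rule linearI)
  fix \<phi> \<psi> :: test_fun and c :: real
  show "tf_deriv (\<phi> + \<psi>) = tf_deriv \<phi> + tf_deriv \<psi>"
    using smooth_add(2)[OF tf_smooth[of \<phi>] tf_smooth[of \<psi>], of 1]
    by (auto intro!: tf_eqI simp: tf_rep_eqs)
  show "tf_deriv (c *\<^sub>R \<phi>) = c *\<^sub>R tf_deriv \<phi>"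
    using smooth_cmult(2)[OF tf_smooth[of \<phi>], of 1 c]
    by (auto intro!: tf_eqI simp: tf_rep_eqs)
qed

section \<open>Distributions on the real line\<close>

text \<open>Continuity of a linear functional for the usual (LF) topology on test functions is expressed
  by the standard seminorm estimate on each compact set.\<close>

definition tf_continuous :: "(test_fun \<Rightarrow> real) \<Rightarrow> bool" where
  "tf_continuous T \<longleftrightarrow> (\<forall>K. compact K \<longrightarrow>
    (\<exists>C m. \<forall>\<phi>. tf_support \<phi> \<subseteq> K \<longrightarrow> \<bar>T \<phi>\<bar> \<le> C * (\<Sum>k\<le>m. tf_seminorm k \<phi>)))"

lemma tf_continuousE:
  assumes "tf_continuous T" "compact K"
  obtains C m where "0 \<le> C"
    "\<And>\<phi>. tf_support \<phi> \<subseteq> K \<Longrightarrow> \<bar>T \<phi>\<bar> \<le> C * (\<Sum>k\<le>m. tf_seminorm k \<phi>)"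
proof -
  from assms obtain C m where
    *: "tf_support \<phi> \<subseteq> K \<Longrightarrow> \<bar>T \<phi>\<bar> \<le> C * (\<Sum>k\<le>m. tf_seminorm k \<phi>)" for \<phi>
    unfolding tf_continuous_def by blast
  show ?thesis
  proof (rule that[of "\<bar>C\<bar>" m])
    fix \<phi> assume "tf_support \<phi> \<subseteq> K"
    from *[OF this] show "\<bar>T \<phi>\<bar> \<le> \<bar>C\<bar> * (\<Sum>k\<le>m. tf_seminorm k \<phi>)"
      by (smt (verit) mult_right_mono sum_nonneg tf_seminorm_nonneg)
  qed simp
qed

typedef distribution = "{T :: test_fun \<Rightarrow> real. linear T \<and> tf_continuous T}"
  morphisms dist_apply Abs_distribution
  by (rule exI[of _ "\<lambda>_. 0"]) (auto simp: tf_continuous_def linear_zero intro: exI[of _ 0])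

setup_lifting type_definition_distribution

lemma dist_linear: "linear (dist_apply T)" and dist_continuous: "tf_continuous (dist_apply T)"
  using dist_apply[of T] by auto

lemma dist_eqI: "(\<And>\<phi>. dist_apply S \<phi> = dist_apply T \<phi>) \<Longrightarrow> S = T"
  by (simp add: dist_apply_inject[symmetric] fun_eq_iff)

instantiation distribution :: real_vector
begin

lift_definition zero_distribution :: distribution is "\<lambda>\<phi>. 0"
  by (auto simp: tf_continuous_def linear_zero intro: exI[of _ 0])

lift_definition plus_distribution :: "distribution \<Rightarrow> distribution \<Rightarrow> distribution"
  is "\<lambda>S T \<phi>. S \<phi> + T \<phi>"
proof -
  fix S T :: "test_fun \<Rightarrow> real"
  assume *: "linear S \<and> tf_continuous S" "linear T \<and> tf_continuous T"
  have "tf_continuous (\<lambda>\<phi>. S \<phi> + T \<phi>)"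
    unfolding tf_continuous_def
  proof (intro allI impI)
    fix K :: "real set" assume K: "compact K"
    obtain A m where A: "0 \<le> A"
      "\<And>\<phi>. tf_support \<phi> \<subseteq> K \<Longrightarrow> \<bar>S \<phi>\<bar> \<le> A * (\<Sum>k\<le>m. tf_seminorm k \<phi>)"
      using tf_continuousE[OF _ K, of S] * by metis
    obtain B n where B: "0 \<le> B"
      "\<And>\<phi>. tf_support \<phi> \<subseteq> K \<Longrightarrow> \<bar>T \<phi>\<bar> \<le> B * (\<Sum>k\<le>n. tf_seminorm k \<phi>)"
      using tf_continuousE[OF _ K, of T] * by metis
    have "\<bar>S \<phi> + T \<phi>\<bar> \<le> (A + B) * (\<Sum>k\<le>max m n. tf_seminorm k \<phi>)"
      if "tf_support \<phi> \<subseteq> K" for \<phi>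
    proof -
      have "(\<Sum>k\<le>m. tf_seminorm k \<phi>) \<le> (\<Sum>k\<le>max m n. tf_seminorm k \<phi>)"
        "(\<Sum>k\<le>n. tf_seminorm k \<phi>) \<le> (\<Sum>k\<le>max m n. tf_seminorm k \<phi>)"
        by (auto intro!: sum_mono2 simp: tf_seminorm_nonneg)
      then have "A * (\<Sum>k\<le>m. tf_seminorm k \<phi>) + B * (\<Sum>k\<le>n. tf_seminorm k \<phi>)
          \<le> (A + B) * (\<Sum>k\<le>max m n. tf_seminorm k \<phi>)"
        using A(1) B(1) by (simp add: distrib_right add_mono mult_left_mono)
      then show ?thesis using A(2)[OF that] B(2)[OF that] by linarith
    qed
    then show "\<exists>C m. \<forall>\<phi>. tf_support \<phi> \<subseteq> K \<longrightarrow> \<bar>S \<phi> + T \<phi>\<bar> \<le> C * (\<Sum>k\<le>m. tf_seminorm k \<phi>)"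
      by blast
  qed
  then show "linear (\<lambda>\<phi>. S \<phi> + T \<phi>) \<and> tf_continuous (\<lambda>\<phi>. S \<phi> + T \<phi>)"
    using * by (simp add: linear_compose_add)
qed

lift_definition scaleR_distribution :: "real \<Rightarrow> distribution \<Rightarrow> distribution"
  is "\<lambda>c T \<phi>. c * T \<phi>"
proof -
  fix c :: real and T :: "test_fun \<Rightarrow> real"
  assume *: "linear T \<and> tf_continuous T"
  have "tf_continuous (\<lambda>\<phi>. c * T \<phi>)"
    unfolding tf_continuous_def
  proof (intro allI impI)
    fix K :: "real set" assume K: "compact K"
    obtain A m where A: "0 \<le> A"
      "\<And>\<phi>. tf_support \<phi> \<subseteq> K \<Longrightarrow> \<bar>T \<phi>\<bar> \<le> A * (\<Sum>k\<le>m. tf_seminorm k \<phi>)"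
      using tf_continuousE[OF _ K, of T] * by metis
    have "\<bar>c * T \<phi>\<bar> \<le> (\<bar>c\<bar> * A) * (\<Sum>k\<le>m. tf_seminorm k \<phi>)" if "tf_support \<phi> \<subseteq> K" for \<phi>
      using mult_left_mono[OF A(2)[OF that], of "\<bar>c\<bar>"] by (simp add: abs_mult mult.assoc)
    then show "\<exists>C m. \<forall>\<phi>. tf_support \<phi> \<subseteq> K \<longrightarrow> \<bar>c * T \<phi>\<bar> \<le> C * (\<Sum>k\<le>m. tf_seminorm k \<phi>)"
      by blast
  qed
  moreover have "linear (\<lambda>\<phi>. c * T \<phi>)"
    using * linear_compose_scale_right[of T c] by simp
  ultimately show "linear (\<lambda>\<phi>. c * T \<phi>) \<and> tf_continuous (\<lambda>\<phi>. c * T \<phi>)" by simp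
qed

definition uminus_distribution :: "distribution \<Rightarrow> distribution" where
  "uminus_distribution T = (- 1) *\<^sub>R T"

definition minus_distribution :: "distribution \<Rightarrow> distribution \<Rightarrow> distribution" where
  "minus_distribution S T = S + (- 1) *\<^sub>R T"

instance
  by standard
    (auto simp: uminus_distribution_def minus_distribution_def plus_distribution.rep_eq
      zero_distribution.rep_eq scaleR_distribution.rep_eq algebra_simps intro!: dist_eqI)

end

lift_definition dist_deriv :: "distribution \<Rightarrow> distribution" is "\<lambda>T \<phi>. - T (tf_deriv \<phi>)"
proof -
  fix T :: "test_fun \<Rightarrow> real"
  assume *: "linear T \<and> tf_continuous T"
  have "tf_continuous (\<lambda>\<phi>. - T (tf_deriv \<phi>))"
    unfolding tf_continuous_def
  proof (intro allI impI)
    fix K :: "real set" assume K: "compact K"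
    obtain A m where A: "0 \<le> A"
      "\<And>\<phi>. tf_support \<phi> \<subseteq> K \<Longrightarrow> \<bar>T \<phi>\<bar> \<le> A * (\<Sum>k\<le>m. tf_seminorm k \<phi>)"
      using tf_continuousE[OF _ K, of T] * by metis
    have "\<bar>- T (tf_deriv \<phi>)\<bar> \<le> A * (\<Sum>k\<le>Suc m. tf_seminorm k \<phi>)" if "tf_support \<phi> \<subseteq> K" for \<phi>
    proof -
      have "(\<Sum>k\<le>m. tf_seminorm k (tf_deriv \<phi>)) = (\<Sum>k\<le>m. tf_seminorm (Suc k) \<phi>)"
        using tf_seminorm_deriv[of _ 1 \<phi>] by simp
      also have "\<dots> \<le> (\<Sum>k\<le>Suc m. tf_seminorm k \<phi>)"
        by (subst sum.atMost_Suc_shift) (simp add: tf_seminorm_nonneg)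
      finally have "A * (\<Sum>k\<le>m. tf_seminorm k (tf_deriv \<phi>)) \<le> A * (\<Sum>k\<le>Suc m. tf_seminorm k \<phi>)"
        using A(1) mult_left_mono by blast
      moreover have "tf_support (tf_deriv \<phi>) \<subseteq> K" using that tf_support_deriv by blast
      ultimately show ?thesis using A(2)[of "tf_deriv \<phi>"] by linarith
    qed
    then show "\<exists>C m. \<forall>\<phi>. tf_support \<phi> \<subseteq> K \<longrightarrow> \<bar>- T (tf_deriv \<phi>)\<bar> \<le> C * (\<Sum>k\<le>m. tf_seminorm k \<phi>)"
      by blast
  qed
  moreover have "linear (\<lambda>\<phi>. - T (tf_deriv \<phi>))"
    using * linear_compose[OF tf_deriv_linear, of T] linear_compose_neg by (auto simp: o_def)
  ultimately show "linear (\<lambda>\<phi>. - T (tf_deriv \<phi>)) \<and> tf_continuous (\<lambda>\<phi>. - T (tf_deriv \<phi>))" by simp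
qed

lift_definition dist_reflect :: "distribution \<Rightarrow> distribution" is "\<lambda>T \<phi>. T (tf_reflect \<phi>)"
proof -
  fix T :: "test_fun \<Rightarrow> real"
  assume *: "linear T \<and> tf_continuous T"
  have "tf_continuous (\<lambda>\<phi>. T (tf_reflect \<phi>))"
    unfolding tf_continuous_def
  proof (intro allI impI)
    fix K :: "real set" assume K: "compact K"
    have K': "compact (uminus ` K)"
      using K by (intro compact_continuous_image continuous_intros)
    obtain A m where A: "0 \<le> A"
      "\<And>\<phi>. tf_support \<phi> \<subseteq> uminus ` K \<Longrightarrow> \<bar>T \<phi>\<bar> \<le> A * (\<Sum>k\<le>m. tf_seminorm k \<phi>)"
      using tf_continuousE[OF _ K', of T] * by metis
    have "\<bar>T (tf_reflect \<phi>)\<bar> \<le> A * (\<Sum>k\<le>m. tf_seminorm k \<phi>)" if "tf_support \<phi> \<subseteq> K" for \<phi>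
    proof -
      have "x \<in> uminus ` K" if "tf_apply (tf_reflect \<phi>) x \<noteq> 0" for x
        using that fun_support_in[of "tf_apply \<phi>" "- x"] \<open>tf_support \<phi> \<subseteq> K\<close>
        by (intro image_eqI[of _ _ "- x"]) (auto simp: tf_rep_eqs)
      then have "tf_support (tf_reflect \<phi>) \<subseteq> uminus ` K"
        by (intro fun_support_leI compact_imp_closed[OF K'])
      from A(2)[OF this] show ?thesis
        using A(1) by (smt (verit) mult_left_mono sum_mono tf_seminorm_reflect)
    qed
    then show "\<exists>C m. \<forall>\<phi>. tf_support \<phi> \<subseteq> K \<longrightarrow> \<bar>T (tf_reflect \<phi>)\<bar> \<le> C * (\<Sum>k\<le>m. tf_seminorm k \<phi>)"
      by blast
  qed
  moreover have "linear (\<lambda>\<phi>. T (tf_reflect \<phi>))"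
    using * linear_compose[OF tf_reflect_linear, of T] by (auto simp: o_def)
  ultimately show "linear (\<lambda>\<phi>. T (tf_reflect \<phi>)) \<and> tf_continuous (\<lambda>\<phi>. T (tf_reflect \<phi>))" by simp
qed

lift_definition dirac :: distribution is "\<lambda>\<phi>. tf_apply \<phi> 0"
proof
  show "linear (\<lambda>\<phi>. tf_apply \<phi> 0)" by (rule linearI) (auto simp: tf_rep_eqs)
  have "\<bar>tf_apply \<phi> 0\<bar> \<le> 1 * (\<Sum>k\<le>0. tf_seminorm k \<phi>)" for \<phi>
    using tf_seminorm_upper[of 0 \<phi> 0] by simp
  then show "tf_continuous (\<lambda>\<phi>. tf_apply \<phi> 0)"
    unfolding tf_continuous_def by blast
qed

definition locally_integrable :: "(real \<Rightarrow> real) \<Rightarrow> bool" where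
  "locally_integrable f \<longleftrightarrow> (\<forall>K. compact K \<longrightarrow> set_integrable lborel K f)"

lemma continuous_locally_integrable:
  "continuous_on UNIV f \<Longrightarrow> locally_integrable f"
  unfolding locally_integrable_def set_integrable_def
  by (intro allI impI borel_integrable_compact) (auto intro: continuous_on_subset)

lemma locally_integrable_times_tf:
  assumes "locally_integrable f"
  shows "integrable lborel (\<lambda>x. f x * tf_apply \<phi> x)"
    and "tf_support \<phi> \<subseteq> K \<Longrightarrow> compact K \<Longrightarrow>
      \<bar>LINT x|lborel. f x * tf_apply \<phi> x\<bar> \<le> (LINT x:K|lborel. \<bar>f x\<bar>) * tf_seminorm 0 \<phi>"
proof -
  have *: "integrable lborel (\<lambda>x. f x * tf_apply \<phi> x) \<and>
      \<bar>LINT x|lborel. f x * tf_apply \<phi> x\<bar> \<le> (LINT x:K|lborel. \<bar>f x\<bar>) * tf_seminorm 0 \<phi>"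
    if K: "tf_support \<phi> \<subseteq> K" "compact K" for K
  proof -
    have fK: "integrable lborel (\<lambda>x. indicator K x * f x)"
      using assms K(2) by (simp add: locally_integrable_def set_integrable_def)
    have eq: "f x * tf_apply \<phi> x = (indicator K x * f x) * tf_apply \<phi> x" for x
      using fun_support_in[of "tf_apply \<phi>" x] K(1) by (auto simp: indicator_def)
    have "continuous_on UNIV (tf_apply \<phi>)"
      using tf_continuous_on[of 0 \<phi>] by simp
    then have [measurable]: "tf_apply \<phi> \<in> borel_measurable borel"
      by (rule borel_measurable_continuous_onI)
    have [measurable]: "(\<lambda>x. indicator K x * f x) \<in> borel_measurable borel"
      using fK by (auto dest: borel_measurable_integrable)
    have bound: "\<bar>f x * tf_apply \<phi> x\<bar> \<le> indicator K x * \<bar>f x\<bar> * tf_seminorm 0 \<phi>" for x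
      unfolding eq using tf_seminorm_upper[of 0 \<phi> x]
      by (auto simp: indicator_def abs_mult intro: mult_left_mono)
    have int: "integrable lborel (\<lambda>x. indicator K x * \<bar>f x\<bar>)"
      using integrable_abs[OF fK] by (simp add: abs_mult)
    then have int': "integrable lborel (\<lambda>x. indicator K x * \<bar>f x\<bar> * tf_seminorm 0 \<phi>)"
      by simp
    have "(\<lambda>x. f x * tf_apply \<phi> x) \<in> borel_measurable lborel"
      unfolding eq by simp
    then have int_f: "integrable lborel (\<lambda>x. f x * tf_apply \<phi> x)"
      by (rule Bochner_Integration.integrable_bound[OF int'])
        (use bound in \<open>auto intro!: AE_I2 intro: order_trans[OF _ abs_ge_self]\<close>)
    have "\<bar>LINT x|lborel. f x * tf_apply \<phi> x\<bar> \<le> (LINT x|lborel. \<bar>f x * tf_apply \<phi> x\<bar>)"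
      using integral_abs_bound by blast
    also have "\<dots> \<le> (LINT x|lborel. indicator K x * \<bar>f x\<bar> * tf_seminorm 0 \<phi>)"
      by (rule integral_mono[OF integrable_abs[OF int_f] int']) (rule bound)
    also have "\<dots> = (LINT x:K|lborel. \<bar>f x\<bar>) * tf_seminorm 0 \<phi>"
      by (simp add: set_lebesgue_integral_def)
    finally show ?thesis using int_f by blast
  qed
  show "integrable lborel (\<lambda>x. f x * tf_apply \<phi> x)"
    using *[OF order_refl tf_compact] by blast
  show "tf_support \<phi> \<subseteq> K \<Longrightarrow> compact K \<Longrightarrow>
      \<bar>LINT x|lborel. f x * tf_apply \<phi> x\<bar> \<le> (LINT x:K|lborel. \<bar>f x\<bar>) * tf_seminorm 0 \<phi>"
    using * by blast
qed

text \<open>The regular distribution of a locally integrable function (and \<open>0\<close> for other functions).\<close>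

lift_definition fun_dist :: "(real \<Rightarrow> real) \<Rightarrow> distribution"
  is "\<lambda>f \<phi>. if locally_integrable f then LINT x|lborel. f x * tf_apply \<phi> x else 0"
proof -
  fix f :: "real \<Rightarrow> real"
  let ?T = "\<lambda>\<phi>. if locally_integrable f then LINT x|lborel. f x * tf_apply \<phi> x else 0"
  show "linear ?T \<and> tf_continuous ?T"
  proof (cases "locally_integrable f")
    case True
    have "linear (\<lambda>\<phi>. LINT x|lborel. f x * tf_apply \<phi> x)"
      using locally_integrable_times_tf(1)[OF True]
      by (intro linearI) (auto simp: tf_rep_eqs distrib_left mult.left_commute)
    moreover have "tf_continuous (\<lambda>\<phi>. LINT x|lborel. f x * tf_apply \<phi> x)"
      unfolding tf_continuous_def
    proof (intro allI impI)
      fix K :: "real set" assume "compact K"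
      then have "\<forall>\<phi>. tf_support \<phi> \<subseteq> K \<longrightarrow> \<bar>LINT x|lborel. f x * tf_apply \<phi> x\<bar>
          \<le> (LINT x:K|lborel. \<bar>f x\<bar>) * (\<Sum>k\<le>0. tf_seminorm k \<phi>)"
        using locally_integrable_times_tf(2)[OF True] by simp
      then show "\<exists>C m. \<forall>\<phi>. tf_support \<phi> \<subseteq> K \<longrightarrow>
          \<bar>LINT x|lborel. f x * tf_apply \<phi> x\<bar> \<le> C * (\<Sum>k\<le>m. tf_seminorm k \<phi>)"
        by blast
    qed
    ultimately show ?thesis using True by simp
  next
    case False
    then show ?thesis by (auto simp: tf_continuous_def linear_zero intro: exI[of _ 0])
  qed
qed

text \<open>For closed \<open>A\<close>, \<open>T\<close> vanishes on the open complement of \<open>A\<close>, i.e. its support is contained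
  in \<open>A\<close>.\<close>

definition dist_supported_in :: "distribution \<Rightarrow> real set \<Rightarrow> bool" where
  "dist_supported_in T A \<longleftrightarrow> (\<forall>\<phi>. tf_support \<phi> \<inter> A = {} \<longrightarrow> dist_apply T \<phi> = 0)"

definition dist_compact_support :: "distribution \<Rightarrow> bool" where
  "dist_compact_support T \<longleftrightarrow> (\<exists>K. compact K \<and> dist_supported_in T K)"

lemma dist_compact_supportE:
  assumes "dist_compact_support T"
  obtains r where "0 < r" "\<And>\<phi>. tf_support \<phi> \<inter> {- r..r} = {} \<Longrightarrow> dist_apply T \<phi> = 0"
proof -
  from assms obtain K where K: "compact K" "dist_supported_in T K"
    unfolding dist_compact_support_def by blast
  obtain r where r: "0 < r" "K \<subseteq> {- r..r}"
    using compact_real_subset_interval[OF K(1)] by blast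
  show ?thesis
  proof (rule that[OF r(1)])
    fix \<phi> assume "tf_support \<phi> \<inter> {- r..r} = {}"
    then have "tf_support \<phi> \<inter> K = {}" using r(2) by blast
    then show "dist_apply T \<phi> = 0" using K(2) by (simp add: dist_supported_in_def)
  qed
qed

section \<open>Convolution with a compactly supported distribution\<close>

lemma tf_shift_quotient_bound:
  assumes "h \<noteq> 0"
  shows "tf_seminorm k ((1 / h) *\<^sub>R (tf_shift (x + h) \<phi> - tf_shift x \<phi>) - tf_shift x (tf_deriv \<phi>))
    \<le> \<bar>h\<bar> * tf_seminorm (k + 2) \<phi>"
proof (rule tf_seminorm_least)
  fix y
  let ?g = "\<lambda>k. (deriv ^^ k) (tf_apply \<phi>)"
  let ?\<psi> = "(1 / h) *\<^sub>R (tf_shift (x + h) \<phi> - tf_shift x \<phi>) - tf_shift x (tf_deriv \<phi>)"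
  have D: "(?g j has_real_derivative ?g (Suc j) z) (at z)" for j z
    by (rule smooth_DERIV[OF tf_smooth])
  have lip: "\<bar>?g (Suc k) a - ?g (Suc k) b\<bar> \<le> tf_seminorm (k + 2) \<phi> * \<bar>a - b\<bar>" for a b
  proof -
    have "norm (?g (Suc k) a - ?g (Suc k) b) \<le> tf_seminorm (k + 2) \<phi> * norm (a - b)"
    proof (rule field_differentiable_bound[of UNIV _ "?g (Suc (Suc k))"])
      fix z
      show "(?g (Suc k) has_real_derivative ?g (Suc (Suc k)) z) (at z within UNIV)"
        by (rule D)
      show "norm (?g (Suc (Suc k)) z) \<le> tf_seminorm (k + 2) \<phi>"
        using tf_seminorm_upper[of "k + 2" \<phi> z] by simp
    qed auto
    then show ?thesis by simp
  qed
  let ?w = "x + y"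
  let ?q = "\<lambda>t. ?g k (?w + t) - t * ?g (Suc k) ?w"
  have q: "norm (?q h - ?q 0) \<le> (tf_seminorm (k + 2) \<phi> * \<bar>h\<bar>) * norm (h - 0)"
  proof (rule field_differentiable_bound[of "closed_segment 0 h" _
        "\<lambda>t. ?g (Suc k) (?w + t) - ?g (Suc k) ?w"])
    fix t assume t: "t \<in> closed_segment 0 h"
    have "((\<lambda>t. ?g k (?w + t)) has_real_derivative ?g (Suc k) (?w + t)) (at t)"
      using D[of k "?w + t"] by (subst (asm) add.commute, subst (asm) DERIV_shift) (simp add: add.commute)
    then have "(?q has_real_derivative ?g (Suc k) (?w + t) - ?g (Suc k) ?w) (at t)"
      by (auto intro!: derivative_eq_intros)
    then show "(?q has_real_derivative ?g (Suc k) (?w + t) - ?g (Suc k) ?w)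
        (at t within closed_segment 0 h)"
      by (rule has_field_derivative_at_within)
    have "\<bar>t\<bar> \<le> \<bar>h\<bar>" using t by (auto simp: closed_segment_eq_real_ivl split: if_splits)
    then show "norm (?g (Suc k) (?w + t) - ?g (Suc k) ?w) \<le> tf_seminorm (k + 2) \<phi> * \<bar>h\<bar>"
      using lip[of "?w + t" ?w] mult_left_mono[OF _ tf_seminorm_nonneg, of "\<bar>t\<bar>" "\<bar>h\<bar>" "k + 2" \<phi>]
      by simp
  qed auto
  have "(deriv ^^ k) (tf_apply ?\<psi>) y = (1 / h) * (?q h - ?q 0)"
    using assms by (simp add: higher_deriv_tf_add higher_deriv_tf_diff higher_deriv_tf_scaleR
        higher_deriv_tf_shift higher_deriv_tf_deriv field_simps del: funpow.simps)
  then have "\<bar>(deriv ^^ k) (tf_apply ?\<psi>) y\<bar> = (1 / \<bar>h\<bar>) * \<bar>?q h - ?q 0\<bar>"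
    by (simp add: abs_mult)
  also have "\<dots> \<le> (1 / \<bar>h\<bar>) * (tf_seminorm (k + 2) \<phi> * \<bar>h\<bar> * \<bar>h\<bar>)"
    using q by (intro mult_left_mono) auto
  also have "\<dots> = \<bar>h\<bar> * tf_seminorm (k + 2) \<phi>"
    using assms by simp
  finally show "\<bar>(deriv ^^ k) (tf_apply ?\<psi>) y\<bar> \<le> \<bar>h\<bar> * tf_seminorm (k + 2) \<phi>" .
qed

lemma dist_shift_has_derivative:
  "((\<lambda>x. dist_apply T (tf_shift x \<phi>)) has_real_derivative dist_apply T (tf_shift x (tf_deriv \<phi>))) (at x)"
proof -
  obtain s where s: "0 < s" "tf_support \<phi> \<subseteq> {- s..s}"
    using compact_real_subset_interval[OF tf_compact] by blast
  let ?K = "{- s - x - 1..s - x + 1}"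
  obtain C m where C: "0 \<le> C"
    "\<And>\<psi>. tf_support \<psi> \<subseteq> ?K \<Longrightarrow> \<bar>dist_apply T \<psi>\<bar> \<le> C * (\<Sum>k\<le>m. tf_seminorm k \<psi>)"
    using tf_continuousE[OF dist_continuous, of ?K T] by blast
  let ?B = "C * (\<Sum>k\<le>m. tf_seminorm (k + 2) \<phi>)"
  let ?f = "\<lambda>x. dist_apply T (tf_shift x \<phi>)"
  let ?D = "dist_apply T (tf_shift x (tf_deriv \<phi>))"
  have bound: "\<bar>(?f (x + h) - ?f x) / h - ?D\<bar> \<le> \<bar>h\<bar> * ?B" if h: "h \<noteq> 0" "\<bar>h\<bar> < 1" for h
  proof -
    let ?\<psi> = "(1 / h) *\<^sub>R (tf_shift (x + h) \<phi> - tf_shift x \<phi>) - tf_shift x (tf_deriv \<phi>)"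
    have "(?f (x + h) - ?f x) / h - ?D = dist_apply T ?\<psi>"
      by (simp only: linear_diff[OF dist_linear] linear_scale[OF dist_linear]) simp
    moreover have "tf_support ?\<psi> \<subseteq> ?K"
    proof (rule fun_support_leI)
      fix y assume "tf_apply ?\<psi> y \<noteq> 0"
      moreover have "tf_apply ?\<psi> y = (1 / h) * (tf_apply \<phi> (x + h + y) - tf_apply \<phi> (x + y))
          - tf_apply (tf_deriv \<phi>) (x + y)"
        using higher_deriv_tf_diff[of 0] higher_deriv_tf_scaleR[of 0] by (simp add: tf_shift.rep_eq)
      ultimately have "tf_apply \<phi> (x + h + y) \<noteq> 0 \<or> tf_apply \<phi> (x + y) \<noteq> 0
          \<or> tf_apply (tf_deriv \<phi>) (x + y) \<noteq> 0"
        by auto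
      then have "x + h + y \<in> {- s..s} \<or> x + y \<in> {- s..s}"
        using s(2) tf_support_deriv[of \<phi>] fun_support_in[of "tf_apply \<phi>" "x + h + y"]
          fun_support_in[of "tf_apply \<phi>" "x + y"] fun_support_in[of "tf_apply (tf_deriv \<phi>)" "x + y"]
        by blast
      then show "y \<in> ?K" using h(2) by auto
    qed simp
    ultimately have "\<bar>(?f (x + h) - ?f x) / h - ?D\<bar> \<le> C * (\<Sum>k\<le>m. tf_seminorm k ?\<psi>)"
      using C(2)[of ?\<psi>] by simp
    also have "\<dots> \<le> C * (\<Sum>k\<le>m. \<bar>h\<bar> * tf_seminorm (k + 2) \<phi>)"
      by (intro mult_left_mono sum_mono tf_shift_quotient_bound h C(1))
    also have "\<dots> = \<bar>h\<bar> * ?B" by (simp add: sum_distrib_left mult.left_commute)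
    finally show ?thesis .
  qed
  have "((\<lambda>h. (?f (x + h) - ?f x) / h - ?D) \<longlongrightarrow> 0) (at 0)"
  proof (rule Lim_null_comparison)
    show "\<forall>\<^sub>F h in at 0. norm ((?f (x + h) - ?f x) / h - ?D) \<le> \<bar>h\<bar> * ?B"
      unfolding eventually_at using bound by (intro exI[of _ 1]) (auto simp: dist_real_def)
    show "((\<lambda>h. \<bar>h\<bar> * ?B) \<longlongrightarrow> 0) (at 0)"
      by (intro tendsto_mult_left_zero tendsto_rabs_zero tendsto_ident_at)
  qed
  then show ?thesis
    unfolding DERIV_def by (rule LIM_zero_cancel)
qed

text \<open>For \<open>T\<close> with compact support, this is the test function
  \<open>x \<mapsto> \<langle>T, \<phi>(x + \<cdot>)\<rangle>\<close>.\<close>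

definition tf_conv :: "distribution \<Rightarrow> test_fun \<Rightarrow> test_fun" where
  "tf_conv T \<phi> = Abs_test_fun (\<lambda>x. dist_apply T (tf_shift x \<phi>))"

lemma dist_shift_smooth:
  "smooth (\<lambda>x. dist_apply T (tf_shift x \<phi>))"
  "(deriv ^^ k) (\<lambda>x. dist_apply T (tf_shift x \<phi>)) = (\<lambda>x. dist_apply T (tf_shift x ((tf_deriv ^^ k) \<phi>)))"
proof -
  let ?F = "\<lambda>k x. dist_apply T (tf_shift x ((tf_deriv ^^ k) \<phi>))"
  have D: "(?F k has_real_derivative ?F (Suc k) x) (at x)" for k x
    using dist_shift_has_derivative[of T "(tf_deriv ^^ k) \<phi>" x] by simp
  show "smooth (\<lambda>x. dist_apply T (tf_shift x \<phi>))"
    by (rule smooth_chainI(1)[where F = ?F, OF _ D]) simp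
  show "(deriv ^^ k) (\<lambda>x. dist_apply T (tf_shift x \<phi>)) = ?F k"
    by (rule smooth_chainI(2)[where F = ?F, OF _ D]) simp
qed

lemma dist_shift_zero:
  assumes "\<And>\<psi>. tf_support \<psi> \<inter> {- r..r} = {} \<Longrightarrow> dist_apply T \<psi> = 0"
    and "tf_support \<phi> \<subseteq> {- s..s}" and "x \<notin> {- (r + s)..r + s}"
  shows "dist_apply T (tf_shift x \<phi>) = 0"
proof (rule assms(1))
  have "tf_support (tf_shift x \<phi>) \<subseteq> {- s - x..s - x}"
    by (rule tf_support_shift[OF assms(2)])
  then show "tf_support (tf_shift x \<phi>) \<inter> {- r..r} = {}"
    using assms(3) by fastforce
qed

lemma tf_apply_tf_conv:
  assumes "dist_compact_support T"
  shows "tf_apply (tf_conv T \<phi>) = (\<lambda>x. dist_apply T (tf_shift x \<phi>))"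
proof -
  obtain r where r: "0 < r" "\<And>\<psi>. tf_support \<psi> \<inter> {- r..r} = {} \<Longrightarrow> dist_apply T \<psi> = 0"
    using dist_compact_supportE[OF assms] by blast
  obtain s where s: "0 < s" "tf_support \<phi> \<subseteq> {- s..s}"
    using compact_real_subset_interval[OF tf_compact] by blast
  have "compact (fun_support (\<lambda>x. dist_apply T (tf_shift x \<phi>)))"
    by (rule compact_fun_supportI[of _ "{- (r + s)..r + s}"])
      (use dist_shift_zero[OF r(2) s(2)] in blast, simp)
  then show ?thesis
    unfolding tf_conv_def by (intro Abs_test_fun_inverse) (simp add: dist_shift_smooth(1))
qed

lemma tf_conv_linear:
  assumes "dist_compact_support T"
  shows "linear (tf_conv T)"
proof (rule linearI)
  show "tf_conv T (\<phi> + \<psi>) = tf_conv T \<phi> + tf_conv T \<psi>" for \<phi> \<psi>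
    by (rule tf_eqI) (simp add: tf_apply_tf_conv[OF assms] plus_test_fun.rep_eq
        linear_add[OF tf_shift_linear] linear_add[OF dist_linear])
  show "tf_conv T (c *\<^sub>R \<phi>) = c *\<^sub>R tf_conv T \<phi>" for c \<phi>
    by (rule tf_eqI) (simp add: tf_apply_tf_conv[OF assms] scaleR_test_fun.rep_eq
        linear_scale[OF tf_shift_linear] linear_scale[OF dist_linear])
qed

text \<open>\<open>\<langle>u * T, \<phi>\<rangle> = \<langle>u(x), \<langle>T(y), \<phi>(x + y)\<rangle>\<rangle>\<close>,
  to be used only when \<open>T\<close> has compact support.\<close>

definition dist_conv :: "distribution \<Rightarrow> distribution \<Rightarrow> distribution" where
  "dist_conv u T = Abs_distribution (\<lambda>\<phi>. dist_apply u (tf_conv T \<phi>))"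

lemma dist_apply_dist_conv:
  assumes "dist_compact_support T"
  shows "dist_apply (dist_conv u T) \<phi> = dist_apply u (tf_conv T \<phi>)"
proof -
  let ?S = "\<lambda>\<phi>. dist_apply u (tf_conv T \<phi>)"
  have "tf_continuous ?S"
    unfolding tf_continuous_def
  proof (intro allI impI)
    fix K :: "real set" assume "compact K"
    then obtain s where s: "0 < s" "K \<subseteq> {- s..s}"
      using compact_real_subset_interval by blast
    obtain r where r: "0 < r" "\<And>\<psi>. tf_support \<psi> \<inter> {- r..r} = {} \<Longrightarrow> dist_apply T \<psi> = 0"
      using dist_compact_supportE[OF assms] by blast
    let ?L = "{- (r + s)..r + s}" and ?M = "{- (r + 2 * s)..r + 2 * s}"
    obtain A m where A: "0 \<le> A"
      "\<And>\<phi>. tf_support \<phi> \<subseteq> ?L \<Longrightarrow> \<bar>dist_apply u \<phi>\<bar> \<le> A * (\<Sum>k\<le>m. tf_seminorm k \<phi>)"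
      using tf_continuousE[OF dist_continuous, of ?L u] by blast
    obtain B n where B: "0 \<le> B"
      "\<And>\<phi>. tf_support \<phi> \<subseteq> ?M \<Longrightarrow> \<bar>dist_apply T \<phi>\<bar> \<le> B * (\<Sum>k\<le>n. tf_seminorm k \<phi>)"
      using tf_continuousE[OF dist_continuous, of ?M T] by blast
    let ?N = "\<lambda>\<phi>. \<Sum>i\<le>m + n. tf_seminorm i \<phi>"
    have "\<bar>?S \<phi>\<bar> \<le> (A * (real (Suc m) * (B * real (Suc n)))) * ?N \<phi>" if "tf_support \<phi> \<subseteq> K" for \<phi>
    proof -
      have \<phi>: "tf_support \<phi> \<subseteq> {- s..s}" using that s(2) by blast
      have N: "0 \<le> ?N \<phi>" by (intro sum_nonneg tf_seminorm_nonneg)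
      have bound: "tf_seminorm k (tf_conv T \<phi>) \<le> B * real (Suc n) * ?N \<phi>" if "k \<le> m" for k
      proof (rule tf_seminorm_least)
        fix x
        let ?\<psi> = "(tf_deriv ^^ k) \<phi>"
        have \<psi>: "tf_support ?\<psi> \<subseteq> {- s..s}" using \<phi> tf_support_deriv_pow[of k \<phi>] by blast
        have "\<bar>dist_apply T (tf_shift x ?\<psi>)\<bar> \<le> B * real (Suc n) * ?N \<phi>"
        proof (cases "x \<in> ?L")
          case True
          have "tf_support (tf_shift x ?\<psi>) \<subseteq> {- s - x..s - x}" by (rule tf_support_shift[OF \<psi>])
          also have "\<dots> \<subseteq> ?M" using True by auto
          finally have "\<bar>dist_apply T (tf_shift x ?\<psi>)\<bar> \<le> B * (\<Sum>j\<le>n. tf_seminorm j (tf_shift x ?\<psi>))"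
            by (rule B(2))
          also have "\<dots> \<le> B * (\<Sum>j\<le>n. ?N \<phi>)"
          proof (intro mult_left_mono sum_mono B(1))
            fix j assume "j \<in> {..n}"
            have "tf_seminorm j (tf_shift x ?\<psi>) \<le> tf_seminorm j ?\<psi>" by (rule tf_seminorm_shift)
            also have "\<dots> = tf_seminorm (j + k) \<phi>" by (rule tf_seminorm_deriv)
            also have "\<dots> \<le> ?N \<phi>"
              using \<open>j \<in> {..n}\<close> \<open>k \<le> m\<close> tf_seminorm_nonneg
              by (intro member_le_sum) auto
            finally show "tf_seminorm j (tf_shift x ?\<psi>) \<le> ?N \<phi>" .
          qed
          also have "\<dots> = B * real (Suc n) * ?N \<phi>" by simp
          finally show ?thesis .
        next
          case False
          then have "dist_apply T (tf_shift x ?\<psi>) = 0"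
            by (intro dist_shift_zero[OF r(2) \<psi>])
          then show ?thesis using B(1) N by simp
        qed
        then show "\<bar>(deriv ^^ k) (tf_apply (tf_conv T \<phi>)) x\<bar> \<le> B * real (Suc n) * ?N \<phi>"
          by (simp only: tf_apply_tf_conv[OF assms] dist_shift_smooth(2))
      qed
      have "tf_support (tf_conv T \<phi>) \<subseteq> ?L"
        using dist_shift_zero[OF r(2) \<phi>]
        by (intro fun_support_leI) (auto simp only: tf_apply_tf_conv[OF assms] closed_atLeastAtMost)
      then have "\<bar>?S \<phi>\<bar> \<le> A * (\<Sum>k\<le>m. tf_seminorm k (tf_conv T \<phi>))" by (rule A(2))
      also have "\<dots> \<le> A * (\<Sum>k\<le>m. B * real (Suc n) * ?N \<phi>)"
        using bound by (intro mult_left_mono sum_mono A(1)) simp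
      also have "\<dots> = (A * (real (Suc m) * (B * real (Suc n)))) * ?N \<phi>" by simp
      finally show ?thesis .
    qed
    then show "\<exists>C m. \<forall>\<phi>. tf_support \<phi> \<subseteq> K \<longrightarrow> \<bar>?S \<phi>\<bar> \<le> C * (\<Sum>k\<le>m. tf_seminorm k \<phi>)"
      by blast
  qed
  moreover have "linear ?S"
    using linear_compose[OF tf_conv_linear[OF assms] dist_linear[of u]] by (simp add: o_def)
  ultimately show ?thesis
    unfolding dist_conv_def by (subst Abs_distribution_inverse) auto
qed

section \<open>Matrix differential operators\<close>

text \<open>The ordinary differential operator with coefficients \<open>a\<^sub>n\<close> is represented by the polynomial
  with coefficients \<open>a\<^sub>n\<close>; composition of operators is multiplication of polynomials
  (see \<open>odo_mult\<close> below), so that the Leibniz determinant over compositions is \<open>det\<close>.\<close>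

definition odo :: "real poly \<Rightarrow> distribution \<Rightarrow> distribution" where
  "odo p T = (\<Sum>k\<le>degree p. coeff p k *\<^sub>R (dist_deriv ^^ k) T)"

definition odo_adjoint :: "real poly \<Rightarrow> real poly" where
  "odo_adjoint p = (\<Sum>k\<le>degree p. monom ((- 1) ^ k * coeff p k) k)"

type_synonym 'n mdo = "real poly ^ 'n ^ 'n"

definition mdo_apply :: "'n::finite mdo \<Rightarrow> distribution ^ 'n \<Rightarrow> distribution ^ 'n" where
  "mdo_apply L f = (\<chi> r. \<Sum>d\<in>UNIV. odo (L $ r $ d) (f $ d))"

definition mdo_apply_matrix :: "'n::finite mdo \<Rightarrow> distribution ^ 'n ^ 'n \<Rightarrow> distribution ^ 'n ^ 'n" where
  "mdo_apply_matrix L G = (\<chi> r c. mdo_apply L (column c G) $ r)"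

definition mdo_invertible :: "'n::finite mdo \<Rightarrow> bool" where
  "mdo_invertible L \<longleftrightarrow> det L \<noteq> 0"

definition mdo_adjoint :: "'n mdo \<Rightarrow> 'n::finite mdo" where
  "mdo_adjoint L = (\<chi> r c. odo_adjoint (L $ c $ r))"

definition causal_green :: "'n::finite mdo \<Rightarrow> distribution ^ 'n ^ 'n \<Rightarrow> bool" where
  "causal_green L G \<longleftrightarrow> mdo_apply_matrix L G = (\<chi> r c. if r = c then dirac else 0)
    \<and> (\<forall>r c. dist_supported_in (G $ r $ c) {0..})"

definition green_adjoint :: "distribution ^ 'n ^ 'n \<Rightarrow> distribution ^ 'n ^ 'n" where
  "green_adjoint G = (\<chi> r c. dist_reflect (G $ c $ r))"

definition matrix_conv :: "distribution ^ 'n ^ 'n \<Rightarrow> distribution ^ 'n \<Rightarrow> distribution ^ 'n" where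
  "matrix_conv G \<rho> = (\<chi> d. \<Sum>d'\<in>UNIV. dist_conv (G $ d $ d') (\<rho> $ d'))"

definition null_space :: "'n::finite mdo \<Rightarrow> (distribution ^ 'n) set" where
  "null_space L = {q. mdo_apply L q = 0}"

definition vec_fun_dist :: "(real \<Rightarrow> real ^ 'n) \<Rightarrow> distribution ^ 'n" where
  "vec_fun_dist v = (\<chi> i. fun_dist (\<lambda>x. v x $ i))"

definition vec_tf_dist :: "test_fun ^ 'n \<Rightarrow> distribution ^ 'n" where
  "vec_tf_dist \<phi> = (\<chi> i. fun_dist (tf_apply (\<phi> $ i)))"

definition vec_pairing :: "distribution ^ 'n \<Rightarrow> test_fun ^ 'n \<Rightarrow> real" where
  "vec_pairing q \<phi> = (\<Sum>i\<in>UNIV. dist_apply (q $ i) (\<phi> $ i))"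

definition admissible_system ::
  "'n::finite mdo \<Rightarrow> nat \<Rightarrow> (nat \<Rightarrow> distribution ^ 'n) \<Rightarrow> (nat \<Rightarrow> test_fun ^ 'n) \<Rightarrow> bool" where
  "admissible_system L N p \<phi> \<longleftrightarrow>
     inj_on p {1..N} \<and> independent (p ` {1..N}) \<and> span (p ` {1..N}) = null_space L
     \<and> (\<forall>n\<in>{1..N}. \<forall>m\<in>{1..N}. vec_pairing (p n) (\<phi> m) = (if m = n then 1 else 0))
     \<and> (\<exists>b\<ge>0. \<forall>n\<in>{1..N}. \<forall>i. tf_support (\<phi> n $ i) \<subseteq> {0..b})"

definition C0 :: "(real \<Rightarrow> real ^ 'n) set" where
  "C0 = {v. continuous_on UNIV v \<and> (v \<longlongrightarrow> 0) at_infinity}"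

definition C_space ::
  "'n::finite mdo \<Rightarrow> nat \<Rightarrow> (nat \<Rightarrow> test_fun ^ 'n) \<Rightarrow> (distribution ^ 'n) set" where
  "C_space L N \<phi> =
     {mdo_apply (mdo_adjoint L) (vec_fun_dist v) + (\<Sum>n = 1..N. a n *\<^sub>R vec_tf_dist (\<phi> n)) | v a.
       v \<in> C0}"

lemma dist_deriv_linear: "linear dist_deriv"
  by (rule linearI) (auto intro!: dist_eqI simp: dist_deriv.rep_eq plus_distribution.rep_eq
      scaleR_distribution.rep_eq)

lemma odo_0: "odo 0 T = 0"
  by (simp add: odo_def)

lemma odo_pCons: "odo (pCons a p) T = a *\<^sub>R T + dist_deriv (odo p T)"
proof (cases "p = 0")
  case True
  then show ?thesis by (simp add: odo_def linear_0[OF dist_deriv_linear])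
next
  case False
  then have "odo (pCons a p) T = (\<Sum>k\<le>Suc (degree p). coeff (pCons a p) k *\<^sub>R (dist_deriv ^^ k) T)"
    by (simp add: odo_def)
  also have "\<dots> = a *\<^sub>R T + (\<Sum>k\<le>degree p. coeff p k *\<^sub>R dist_deriv ((dist_deriv ^^ k) T))"
    by (subst sum.atMost_Suc_shift) simp
  finally show ?thesis
    by (simp add: odo_def linear_sum[OF dist_deriv_linear] linear_scale[OF dist_deriv_linear])
qed

lemma odo_add: "odo (p + q) T = odo p T + odo q T"
  by (induction p q rule: poly_induct2)
    (simp_all add: odo_0 odo_pCons linear_add[OF dist_deriv_linear] scaleR_add_left)

lemma odo_smult: "odo (smult c p) T = c *\<^sub>R odo p T"
  by (induction p)
    (simp_all add: odo_0 odo_pCons linear_scale[OF dist_deriv_linear] scaleR_add_right)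

lemma odo_mult: "odo (p * q) T = odo p (odo q T)"
  by (induction p) (simp_all add: odo_0 odo_pCons odo_add odo_smult)

lemma coeff_odo_adjoint: "coeff (odo_adjoint p) n = (- 1) ^ n * coeff p n"
  by (simp add: odo_adjoint_def coeff_sum coeff_eq_0)

end

theory Submission
  imports Defs
begin

text \<open>Let \<open>P = det L\<close> and let \<open>P\<^sup>*\<close> be its formal adjoint. The Green's matrix inverts \<open>L\<close> from
both sides, so \<open>L\<^sup>* v = \<rho>\<close>. The function \<open>v\<close> is continuous but need not decay: to the left of the
support of \<open>\<rho>\<close> it is some solution of \<open>L\<^sup>* v = 0\<close>, typically a growing exponential polynomial.
The proof replaces it by a compactly supported continuous function in two moves.

First, a parametrix removes everything that is not smooth. There are a compactly supported
distribution \<open>T\<close> and a test function \<open>\<psi>\<close> with \<open>P\<^sup>* T = \<delta> - \<psi>\<close> (\<open>ex_parametrix\<close>).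
Put \<open>w = v - v * \<psi>\<close>. It is continuous, and \<open>w = v * P\<^sup>* T = (P\<^sup>* v) * T\<close>. Cramer's rule
writes \<open>P\<^sup>* v\<close> as a differential operator applied to \<open>\<rho>\<close>, so \<open>P\<^sup>* v\<close>, and hence \<open>w\<close>, has
compact support. Moreover \<open>L\<^sup>* w = \<rho> - \<rho> * \<psi>\<close>, and \<open>f = \<rho> * \<psi>\<close> is a vector of test functions
(\<open>compact_continuous_decomposition\<close>).

Second, the theorem is proved for the test function \<open>f\<close>. Subtracting \<open>\<Sum> \<langle>p\<^sub>n, f\<rangle> \<phi>\<^sub>n\<close> leaves a test
function \<open>h\<close> that annihilates the null space of \<open>L\<close>. Then \<open>u = G\<^sup>* * h\<close> is smooth, solves
\<open>L\<^sup>* u = h\<close> and vanishes far to the right because \<open>G\<close> is causal. It also vanishes far to the left: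
\<open>L\<close> has an anticausal Green's matrix as well, the columns of the difference of the two Green's
matrices and all their translates lie in the null space of \<open>L\<close>, and therefore \<open>h\<close> does not see
which of the two is used (\<open>null_space_annihilator_in_adjoint_range\<close>). Altogether
\<open>\<rho> = L\<^sup>* (w + u) + \<Sum> \<langle>p\<^sub>n, f\<rangle> \<phi>\<^sub>n\<close> with \<open>w + u\<close> continuous of compact support.

Both the parametrix and the anticausal fundamental solution come from a single entire solution of the
scalar equation \<open>Q(D) h = 0\<close>, given by a power series (\<open>ex_ode_solution\<close>). That \<open>G\<close> is also a left
inverse rests on uniqueness of causal solutions (\<open>causal_solution_unique\<close>).\<close>

section \<open>Smooth functions and cutoffs\<close>

text \<open>Membership in any class of differentiable functions that is closed under differentiation gives
smoothness; this spares explicit formulas for higher derivatives.\<close>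

lemma smooth_coinduct:
  assumes "S f"
    and step: "\<And>f. S f \<Longrightarrow> \<exists>f'. S f' \<and> (\<forall>x. (f has_real_derivative f' x) (at x))"
  shows "smooth f"
proof -
  have "S ((deriv ^^ k) f)" for k
  proof (induction k)
    case (Suc k)
    then obtain f' where "S f'" "\<And>x. ((deriv ^^ k) f has_real_derivative f' x) (at x)"
      using step by blast
    then have "deriv ((deriv ^^ k) f) = f'"
      by (intro ext DERIV_imp_deriv)
    then show ?case using \<open>S f'\<close> by simp
  qed (simp add: assms(1))
  then show ?thesis
    unfolding smooth_def using step real_differentiable_def by blast
qed

lemma smooth_imp_DERIV: "smooth f \<Longrightarrow> (f has_real_derivative deriv f x) (at x)"
  using smooth_DERIV[of f 0 x] by simp

lemma smooth_imp_continuous_on: "smooth f \<Longrightarrow> continuous_on A f"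
  by (intro continuous_at_imp_continuous_on ballI DERIV_isCont[OF smooth_imp_DERIV])

lemma smooth_deriv_funpow: "smooth f \<Longrightarrow> smooth ((deriv ^^ k) f)"
  by (induction k) (auto intro: smooth_deriv)

text \<open>By the product rule this class is closed under differentiation, while products alone are not.\<close>

inductive sum_of_smooth_products :: "(real \<Rightarrow> real) \<Rightarrow> bool" where
  "smooth f \<Longrightarrow> smooth g \<Longrightarrow> sum_of_smooth_products (\<lambda>x. f x * g x)"
| "sum_of_smooth_products f \<Longrightarrow> sum_of_smooth_products g \<Longrightarrow> sum_of_smooth_products (\<lambda>x. f x + g x)"

lemma smooth_mult:
  assumes "smooth f" "smooth g"
  shows "smooth (\<lambda>x. f x * g x)"
proof (rule smooth_coinduct[of sum_of_smooth_products])
  show "sum_of_smooth_products (\<lambda>x. f x * g x)"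
    using assms by (rule sum_of_smooth_products.intros)
  fix k assume "sum_of_smooth_products k"
  then show "\<exists>k'. sum_of_smooth_products k' \<and> (\<forall>x. (k has_real_derivative k' x) (at x))"
  proof induction
    case (1 f g)
    have "sum_of_smooth_products (\<lambda>x. f x * deriv g x + deriv f x * g x)"
      using 1 by (intro sum_of_smooth_products.intros smooth_deriv)
    then show ?case
      using 1 by (auto intro!: exI derivative_eq_intros smooth_imp_DERIV)
  next
    case (2 f g)
    then obtain f' g' where "sum_of_smooth_products f'" "sum_of_smooth_products g'"
      "\<And>x. (f has_real_derivative f' x) (at x)" "\<And>x. (g has_real_derivative g' x) (at x)"
      by blast
    then show ?case
      by (intro exI[of _ "\<lambda>x. f' x + g' x"]) (auto intro!: sum_of_smooth_products.intros derivative_intros)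
  qed
qed

lemma smooth_sum: "(\<And>i. i \<in> A \<Longrightarrow> smooth (f i)) \<Longrightarrow> smooth (\<lambda>x. \<Sum>i\<in>A. f i x)"
  by (induction A rule: infinite_finite_induct) (auto intro: smooth_add smooth_zero)

text \<open>These functions vanish to infinite order at \<open>0\<close>. The polynomial factor makes the class closed
under differentiation, so that smoothness follows from first derivatives alone.\<close>

definition flat_exp :: "real poly \<Rightarrow> real \<Rightarrow> real" where
  "flat_exp p x = (if 0 < x then poly p (1 / x) * exp (- (1 / x)) else 0)"

lemma poly_times_exp_neg_tendsto_0: "((\<lambda>y. poly p y * exp (- y)) \<longlongrightarrow> (0::real)) at_top"
proof -
  have "((\<lambda>y. \<Sum>i\<le>degree p. coeff p i * (y ^ i / exp y)) \<longlongrightarrow> (\<Sum>i\<le>degree p. coeff p i * 0)) at_top"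
    by (intro tendsto_intros tendsto_power_div_exp_0)
  then show ?thesis
    by (simp add: poly_altdef exp_minus sum_distrib_right divide_inverse mult.assoc)
qed

lemma flat_exp_has_derivative:
  "(flat_exp p has_real_derivative flat_exp ([:0, 0, 1:] * (p - pderiv p)) x) (at x)"
proof -
  let ?q = "[:0, 0, 1:] * (p - pderiv p)"
  consider "x < 0" | "0 < x" | "x = 0" by linarith
  then show ?thesis
  proof cases
    case 1
    have "((\<lambda>_. 0) has_real_derivative flat_exp ?q x) (at x)"
      using 1 by (simp add: flat_exp_def)
    then show ?thesis
      by (rule has_field_derivative_transform_within_open[where S = "{..<0}"])
        (use 1 in \<open>auto simp: flat_exp_def\<close>)
  next
    case 2
    have "((\<lambda>x. poly p (1 / x) * exp (- (1 / x))) has_real_derivative flat_exp ?q x) (at x)"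
      using 2 by (auto intro!: derivative_eq_intros DERIV_chain2[OF poly_DERIV]
          simp: flat_exp_def field_simps power2_eq_square)
    then show ?thesis
      by (rule has_field_derivative_transform_within_open[where S = "{0<..}"])
        (use 2 in \<open>auto simp: flat_exp_def\<close>)
  next
    case 3
    have "((\<lambda>h. poly ([:0, 1:] * p) (inverse h) * exp (- inverse h)) \<longlongrightarrow> 0) (at_right (0::real))"
      by (rule filterlim_compose[OF poly_times_exp_neg_tendsto_0 filterlim_inverse_at_top_right])
    then have "((\<lambda>h. flat_exp p h / h) \<longlongrightarrow> 0) (at_right 0)"
      by (rule Lim_transform_eventually)
        (auto simp: flat_exp_def eventually_at_filter field_simps)
    moreover have "((\<lambda>h. flat_exp p h / h) \<longlongrightarrow> 0) (at_left 0)"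
      by (rule tendsto_eventually) (auto simp: flat_exp_def eventually_at_filter)
    ultimately have "((\<lambda>h. flat_exp p h / h) \<longlongrightarrow> 0) (at 0)"
      by (simp add: filterlim_at_split)
    then show ?thesis
      using 3 by (simp add: DERIV_def flat_exp_def)
  qed
qed

lemma smooth_flat_exp: "smooth (flat_exp p)"
  by (rule smooth_coinduct[of "\<lambda>f. \<exists>p. f = flat_exp p"]) (use flat_exp_has_derivative in blast)+

lemma ex_bump:
  fixes a b :: real
  obtains \<eta> where "\<And>x. 0 \<le> tf_apply \<eta> x" "\<And>x. 0 < tf_apply \<eta> x \<longleftrightarrow> a < x \<and> x < b"
    "tf_support \<eta> \<subseteq> {a..b}"
proof -
  let ?e = "flat_exp 1"
  let ?f = "\<lambda>x. ?e (- a + x) * ?e (b + - x)"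
  have "smooth (\<lambda>x. ?e (b + - x))"
    by (rule smooth_reflect(1)[OF smooth_shift(1)[OF smooth_flat_exp]])
  then have sm: "smooth ?f"
    by (intro smooth_mult smooth_shift(1) smooth_flat_exp)
  have pos: "0 \<le> ?f x" "0 < ?f x \<longleftrightarrow> a < x \<and> x < b" for x
    by (auto simp: flat_exp_def)
  have nz: "?f x \<noteq> 0 \<Longrightarrow> x \<in> {a..b}" for x
    by (auto simp: flat_exp_def split: if_splits)
  then have "compact (fun_support ?f)"
    by (intro compact_fun_supportI[OF nz]) auto
  with sm have eq: "tf_apply (Abs_test_fun ?f) = ?f"
    by (intro Abs_test_fun_inverse) auto
  show ?thesis
  proof (rule that[of "Abs_test_fun ?f"], unfold eq)
    show "fun_support ?f \<subseteq> {a..b}" by (rule fun_support_leI[OF nz]) auto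
  qed (fact pos)+
qed

text \<open>The quotients \<open>f / g\<^sup>k\<close> with \<open>f\<close> smooth and \<open>k\<close> arbitrary are closed under differentiation.\<close>

lemma smooth_divide:
  assumes "smooth f" "smooth g" and nz: "\<And>x. g x \<noteq> 0"
  shows "smooth (\<lambda>x. f x / g x)"
proof (rule smooth_coinduct[of "\<lambda>q. \<exists>f k. smooth f \<and> q = (\<lambda>x. f x / g x ^ k)"])
  show "\<exists>f' k. smooth f' \<and> (\<lambda>x. f x / g x) = (\<lambda>x. f' x / g x ^ k)"
    by (rule exI[of _ f], rule exI[of _ 1]) (simp add: assms(1))
  fix q assume "\<exists>f k. smooth f \<and> q = (\<lambda>x. f x / g x ^ k)"
  then obtain f k where f: "smooth f" and q: "q = (\<lambda>x. f x / g x ^ k)" by blast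
  let ?h = "\<lambda>x. deriv f x * g x + (- real k) * (f x * deriv g x)"
  have "smooth ?h"
    using f assms(2) by (intro smooth_add(1) smooth_cmult(1) smooth_mult smooth_deriv(1))
  moreover have "(q has_real_derivative ?h x / g x ^ Suc k) (at x)" for x
  proof (cases k)
    case 0
    then show ?thesis using smooth_imp_DERIV[OF f] nz[of x] by (simp add: q)
  next
    case (Suc m)
    have "((\<lambda>x. g x ^ Suc m) has_real_derivative real (Suc m) * (deriv g x * g x ^ m)) (at x)"
      using DERIV_power[OF smooth_imp_DERIV[OF assms(2)], of "Suc m"] by simp
    from DERIV_divide[OF smooth_imp_DERIV[OF f] this]
    have "((\<lambda>x. f x / g x ^ Suc m) has_real_derivative
        (deriv f x * g x ^ Suc m - f x * (real (Suc m) * (deriv g x * g x ^ m)))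
          / (g x ^ Suc m * g x ^ Suc m)) (at x)"
      using nz[of x] by simp
    also have "(deriv f x * g x ^ Suc m - f x * (real (Suc m) * (deriv g x * g x ^ m)))
        / (g x ^ Suc m * g x ^ Suc m) = ?h x / g x ^ Suc k"
      using nz[of x] by (simp add: Suc divide_simps) algebra
    finally show ?thesis by (simp add: q Suc)
  qed
  ultimately show "\<exists>q'. (\<exists>f k. smooth f \<and> q' = (\<lambda>x. f x / g x ^ k)) \<and>
      (\<forall>x. (q has_real_derivative q' x) (at x))"
    by blast
qed

lemma ex_smooth_step:
  obtains \<kappa> where "smooth \<kappa>" "\<And>x. x \<le> 0 \<Longrightarrow> \<kappa> x = 1" "\<And>x. 1 \<le> x \<Longrightarrow> \<kappa> x = 0"
proof (rule that)
  let ?e = "flat_exp 1"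
  let ?\<kappa> = "\<lambda>x. ?e (1 + - x) / (?e (1 + - x) + ?e x)"
  have sm: "smooth (\<lambda>x. ?e (1 + - x))"
    by (rule smooth_reflect(1)[OF smooth_shift(1)[OF smooth_flat_exp]])
  have pos: "0 < ?e (1 + - x) + ?e x" for x
  proof (cases "0 < x")
    case True
    then have "0 < ?e x" by (simp add: flat_exp_def)
    moreover have "0 \<le> ?e (1 + - x)" by (simp add: flat_exp_def)
    ultimately show ?thesis by simp
  qed (simp add: flat_exp_def)
  show "smooth ?\<kappa>"
    by (rule smooth_divide[OF sm smooth_add(1)[OF sm smooth_flat_exp]]) (use pos in \<open>metis less_irrefl\<close>)
  show "?\<kappa> x = 1" if "x \<le> 0" for x using pos[of x] that by (simp add: flat_exp_def)
  show "?\<kappa> x = 0" if "1 \<le> x" for x using that by (simp add: flat_exp_def)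
qed

section \<open>Distributions given by functions\<close>

lemma dist_apply_diff: "dist_apply (S - T) \<phi> = dist_apply S \<phi> - dist_apply T \<phi>"
  unfolding minus_distribution_def plus_distribution.rep_eq scaleR_distribution.rep_eq by simp

lemma dist_apply_minus: "dist_apply (- T) \<phi> = - dist_apply T \<phi>"
  unfolding uminus_distribution_def scaleR_distribution.rep_eq by simp

lemma tf_apply_minus: "tf_apply (- \<phi>) x = - tf_apply \<phi> x"
  unfolding uminus_test_fun_def scaleR_test_fun.rep_eq by simp

lemma dist_apply_sum: "dist_apply (\<Sum>i\<in>A. T i) \<phi> = (\<Sum>i\<in>A. dist_apply (T i) \<phi>)"
  by (induction A rule: infinite_finite_induct) (simp_all add: zero_distribution.rep_eq plus_distribution.rep_eq)

lemmas dist_apply_arith = zero_distribution.rep_eq plus_distribution.rep_eq scaleR_distribution.rep_eq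
  dist_apply_diff dist_apply_sum

lemma dist_apply_fun_dist:
  "locally_integrable f \<Longrightarrow> dist_apply (fun_dist f) \<phi> = (LINT x|lborel. f x * tf_apply \<phi> x)"
  by (simp add: fun_dist.rep_eq)

lemma tf_locally_integrable: "locally_integrable (tf_apply \<phi>)"
  by (intro continuous_locally_integrable smooth_imp_continuous_on tf_smooth)

lemma locally_integrable_cutoff:
  assumes "continuous_on UNIV f"
  shows "locally_integrable (\<lambda>x. f x * indicator {..<0} x)"
proof -
  have "set_integrable lborel (K \<inter> {..<0}) f" if "compact K" for K
    using continuous_locally_integrable[OF assms] that set_integrable_subset[of lborel K f "K \<inter> {..<0}"]
    unfolding locally_integrable_def by (auto simp: compact_imp_closed borel_closed)
  then show ?thesis
    unfolding locally_integrable_def set_integrable_def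
    by (auto simp: indicator_inter_arith mult.commute mult.left_commute)
qed

lemma fun_dist_add:
  assumes "locally_integrable f" "locally_integrable g"
  shows "locally_integrable (\<lambda>x. f x + g x)" "fun_dist (\<lambda>x. f x + g x) = fun_dist f + fun_dist g"
proof -
  show *: "locally_integrable (\<lambda>x. f x + g x)"
    using assms unfolding locally_integrable_def by (auto intro: set_integral_add)
  show "fun_dist (\<lambda>x. f x + g x) = fun_dist f + fun_dist g"
    using * assms locally_integrable_times_tf(1)
    by (intro dist_eqI) (simp add: dist_apply_fun_dist plus_distribution.rep_eq distrib_right)
qed

lemma fun_dist_cmult:
  assumes "locally_integrable f"
  shows "locally_integrable (\<lambda>x. c * f x)" "fun_dist (\<lambda>x. c * f x) = c *\<^sub>R fun_dist f"
proof -
  show *: "locally_integrable (\<lambda>x. c * f x)"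
    using assms unfolding locally_integrable_def by auto
  show "fun_dist (\<lambda>x. c * f x) = c *\<^sub>R fun_dist f"
    using * assms
    by (intro dist_eqI) (simp add: dist_apply_fun_dist scaleR_distribution.rep_eq mult.assoc)
qed

lemma fun_dist_diff:
  assumes "locally_integrable f" "locally_integrable g"
  shows "fun_dist (\<lambda>x. f x - g x) = fun_dist f - fun_dist g"
proof -
  have "locally_integrable (\<lambda>x. f x - g x)"
    using assms unfolding locally_integrable_def by (auto intro: set_integral_diff)
  then show ?thesis
    using assms locally_integrable_times_tf(1)
    by (intro dist_eqI) (simp add: dist_apply_fun_dist dist_apply_arith left_diff_distrib)
qed

lemma fun_dist_zero: "fun_dist (\<lambda>x. 0) = 0"
  using fun_dist_cmult(2)[OF tf_locally_integrable, of 0 0] by simp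

lemma locally_integrable_zero: "locally_integrable (\<lambda>x. 0)"
  by (rule continuous_locally_integrable) simp

lemma fun_dist_sum:
  assumes "\<And>i. i \<in> A \<Longrightarrow> locally_integrable (f i)"
  shows "locally_integrable (\<lambda>x. \<Sum>i\<in>A. f i x) \<and> fun_dist (\<lambda>x. \<Sum>i\<in>A. f i x) = (\<Sum>i\<in>A. fun_dist (f i))"
  using assms
  by (induction A rule: infinite_finite_induct)
    (auto simp: fun_dist_zero locally_integrable_zero fun_dist_add)

lemma tf_zero_outside: "tf_support \<phi> \<subseteq> K \<Longrightarrow> x \<notin> K \<Longrightarrow> tf_apply \<phi> x = 0"
  using fun_support_in by blast

lemma integral_deriv_times_tf:
  assumes "\<And>x. (f has_real_derivative f' x) (at x)" "continuous_on UNIV f'"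
    and "tf_support \<phi> \<subseteq> {- s..s}" "a \<le> b"
  shows "(LINT x|lborel. (f' x * tf_apply \<phi> x + f x * tf_apply (tf_deriv \<phi>) x) * indicator {a..b} x)
     = f b * tf_apply \<phi> b - f a * tf_apply \<phi> a"
proof (rule integral_FTC_Icc_real[OF assms(4)])
  show "((\<lambda>x. f x * tf_apply \<phi> x) has_real_derivative
      f' x * tf_apply \<phi> x + f x * tf_apply (tf_deriv \<phi>) x) (at x)" for x
    using smooth_imp_DERIV[OF tf_smooth, of \<phi> x] assms(1)[of x]
    by (auto intro!: derivative_eq_intros simp: tf_deriv.rep_eq)
  have "continuous_on UNIV f"
    using assms(1) by (intro continuous_at_imp_continuous_on ballI DERIV_isCont)
  then have "continuous_on UNIV (\<lambda>x. f' x * tf_apply \<phi> x + f x * tf_apply (tf_deriv \<phi>) x)"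
    by (intro continuous_intros assms(2) smooth_imp_continuous_on[OF tf_smooth])
  then show "isCont (\<lambda>x. f' x * tf_apply \<phi> x + f x * tf_apply (tf_deriv \<phi>) x) x" for x
    by (simp add: continuous_on_eq_continuous_at)
qed

lemma dist_deriv_fun_dist:
  assumes D: "\<And>x. (f has_real_derivative f' x) (at x)" and f': "continuous_on UNIV f'"
  shows "dist_deriv (fun_dist f) = fun_dist f'"
proof (rule dist_eqI)
  fix \<phi>
  obtain s where s: "0 < s" "tf_support \<phi> \<subseteq> {- s..s}"
    using compact_real_subset_interval[OF tf_compact] by blast
  have f: "continuous_on UNIV f"
    using D by (intro continuous_at_imp_continuous_on ballI DERIV_isCont)
  note li = continuous_locally_integrable[OF f] continuous_locally_integrable[OF f']
  have s': "tf_support \<phi> \<subseteq> {- (s + 1)..s + 1}" using s by auto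
  have z: "tf_apply \<phi> x = 0" "tf_apply (tf_deriv \<phi>) x = 0" if "x \<notin> {-s..s}" for x
    using tf_zero_outside[OF s(2) that] tf_zero_outside[OF order_trans[OF tf_support_deriv s(2)] that] by auto
  have "(LINT x|lborel. f' x * tf_apply \<phi> x) + (LINT x|lborel. f x * tf_apply (tf_deriv \<phi>) x)
      = (LINT x|lborel. f' x * tf_apply \<phi> x + f x * tf_apply (tf_deriv \<phi>) x)"
    by (rule Bochner_Integration.integral_add[symmetric])
      (intro locally_integrable_times_tf li)+
  also have "\<dots> = (LINT x|lborel. (f' x * tf_apply \<phi> x + f x * tf_apply (tf_deriv \<phi>) x) * indicator {- (s+1)..s+1} x)"
  proof (intro Bochner_Integration.integral_cong refl)
    fix x
    show "f' x * tf_apply \<phi> x + f x * tf_apply (tf_deriv \<phi>) x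
        = (f' x * tf_apply \<phi> x + f x * tf_apply (tf_deriv \<phi>) x) * indicator {- (s+1)..s+1} x"
      using z[of x] s(1) by (cases "x \<in> {-s..s}") auto
  qed
  also have "\<dots> = f (s+1) * tf_apply \<phi> (s+1) - f (-(s+1)) * tf_apply \<phi> (-(s+1))"
    using s(1) by (intro integral_deriv_times_tf[OF D f' s']) auto
  also have "\<dots> = 0" using z(1)[of "s+1"] z(1)[of "-(s+1)"] s(1) by simp
  finally show "dist_apply (dist_deriv (fun_dist f)) \<phi> = dist_apply (fun_dist f') \<phi>"
    using li by (simp add: dist_deriv.rep_eq dist_apply_fun_dist)
qed

text \<open>Cutting a function off at \<open>0\<close> produces a jump, which the derivative turns into a point mass.\<close>

lemma dist_deriv_cutoff:
  assumes D: "\<And>x. (f has_real_derivative f' x) (at x)" and f': "continuous_on UNIV f'"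
  shows "dist_deriv (fun_dist (\<lambda>x. f x * indicator {..<0} x))
    = fun_dist (\<lambda>x. f' x * indicator {..<0} x) - f 0 *\<^sub>R dirac"
proof (rule dist_eqI)
  fix \<phi>
  obtain s where s: "0 < s" "tf_support \<phi> \<subseteq> {- s..s}"
    using compact_real_subset_interval[OF tf_compact] by blast
  have f: "continuous_on UNIV f"
    using D by (intro continuous_at_imp_continuous_on ballI DERIV_isCont)
  note li = locally_integrable_cutoff[OF f] locally_integrable_cutoff[OF f']
  have s': "tf_support \<phi> \<subseteq> {- (s + 1)..s + 1}" using s by auto
  have z: "tf_apply \<phi> x = 0" "tf_apply (tf_deriv \<phi>) x = 0" if "x \<notin> {-s..s}" for x
    using tf_zero_outside[OF s(2) that] tf_zero_outside[OF order_trans[OF tf_support_deriv s(2)] that] by auto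
  have "(LINT x|lborel. f' x * indicator {..<0} x * tf_apply \<phi> x) + (LINT x|lborel. f x * indicator {..<0} x * tf_apply (tf_deriv \<phi>) x)
      = (LINT x|lborel. f' x * indicator {..<0} x * tf_apply \<phi> x + f x * indicator {..<0} x * tf_apply (tf_deriv \<phi>) x)"
    by (rule Bochner_Integration.integral_add[symmetric])
      (intro locally_integrable_times_tf li)+
  also have "\<dots> = (LINT x|lborel. (f' x * tf_apply \<phi> x + f x * tf_apply (tf_deriv \<phi>) x) * indicator {- (s+1)..0} x)"
  proof (rule integral_cong_AE)
    show "AE x in lborel. f' x * indicator {..<0} x * tf_apply \<phi> x + f x * indicator {..<0} x * tf_apply (tf_deriv \<phi>) x
      = (f' x * tf_apply \<phi> x + f x * tf_apply (tf_deriv \<phi>) x) * indicator {- (s+1)..0} x"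
      using AE_lborel_singleton[of "0::real"] by eventually_elim (use z in \<open>auto simp: indicator_def\<close>)
    note [measurable] = borel_measurable_continuous_onI[OF f] borel_measurable_continuous_onI[OF f']
      borel_measurable_continuous_onI[OF smooth_imp_continuous_on[OF tf_smooth]]
    show "(\<lambda>x. f' x * indicator {..<0} x * tf_apply \<phi> x + f x * indicator {..<0} x * tf_apply (tf_deriv \<phi>) x) \<in> borel_measurable lborel"
      by measurable
    show "(\<lambda>x. (f' x * tf_apply \<phi> x + f x * tf_apply (tf_deriv \<phi>) x) * indicator {- (s+1)..0} x) \<in> borel_measurable lborel"
      by measurable
  qed
  also have "\<dots> = f 0 * tf_apply \<phi> 0 - f (-(s+1)) * tf_apply \<phi> (-(s+1))"
    using s(1) by (intro integral_deriv_times_tf[OF D f' s']) auto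
  also have "\<dots> = f 0 * tf_apply \<phi> 0" using z(1)[of "-(s+1)"] s(1) by simp
  finally show "dist_apply (dist_deriv (fun_dist (\<lambda>x. f x * indicator {..<0} x))) \<phi>
      = dist_apply (fun_dist (\<lambda>x. f' x * indicator {..<0} x) - f 0 *\<^sub>R dirac) \<phi>"
    using li by (simp add: dist_deriv.rep_eq dist_apply_fun_dist dist_apply_arith dirac.rep_eq)
qed

text \<open>If \<open>f x \<noteq> 0\<close> then \<open>f x * f y > 0\<close> for \<open>y\<close> near \<open>x\<close>, and a bump function located there detects
\<open>f\<close>.\<close>

lemma continuous_zero_if_fun_dist_supported:
  assumes f: "continuous_on UNIV f" and K: "dist_supported_in (fun_dist f) K" "closed K"
    and x: "x \<notin> K"
  shows "f x = 0"
proof (rule ccontr)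
  assume nz: "f x \<noteq> 0"
  have "open {y. 0 < f x * f y}"
    using f by (intro open_Collect_less continuous_intros)
  then have "open ({y. 0 < f x * f y} \<inter> - K)" using K(2) by (intro open_Int open_Compl)
  moreover have "x \<in> {y. 0 < f x * f y} \<inter> - K"
    using nz x by (auto simp: zero_less_mult_iff)
  ultimately obtain d where d: "0 < d" "cball x d \<subseteq> {y. 0 < f x * f y} \<inter> - K"
    using open_contains_cball by metis
  let ?I = "{x - d..x + d}"
  have I: "0 < f x * f y" "y \<notin> K" if "y \<in> ?I" for y
  proof -
    have "y \<in> cball x d" using that by (auto simp: dist_real_def)
    then show "0 < f x * f y" "y \<notin> K" using d(2) by blast+
  qed
  obtain \<eta> where \<eta>: "\<And>y. 0 \<le> tf_apply \<eta> y" "\<And>y. 0 < tf_apply \<eta> y \<longleftrightarrow> x - d < y \<and> y < x + d"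
    "tf_support \<eta> \<subseteq> ?I"
    by (rule ex_bump[of "x - d" "x + d"]) (rule that)
  let ?g = "\<lambda>y. f x * f y * tf_apply \<eta> y"
  have g: "continuous_on ?I ?g"
    by (intro continuous_intros continuous_on_subset[OF f] smooth_imp_continuous_on tf_smooth) simp
  have "tf_support \<eta> \<inter> K = {}" using I(2) \<eta>(3) by blast
  then have "0 = f x * dist_apply (fun_dist f) \<eta>"
    using K(1) by (simp add: dist_supported_in_def)
  also have "\<dots> = (LINT y|lborel. f x * (f y * tf_apply \<eta> y))"
    by (simp add: dist_apply_fun_dist continuous_locally_integrable f)
  also have "\<dots> = (LINT y:?I|lborel. ?g y)"
    unfolding set_lebesgue_integral_def
  proof (intro Bochner_Integration.integral_cong refl)
    show "f x * (f y * tf_apply \<eta> y) = indicator ?I y *\<^sub>R ?g y" for y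
      using tf_zero_outside[OF \<eta>(3), of y] by (cases "y \<in> ?I") simp_all
  qed
  also have "\<dots> = integral ?I ?g"
    by (rule set_borel_integral_eq_integral(2))
      (simp add: set_integrable_def borel_integrable_compact[OF compact_Icc g, simplified])
  finally have "\<forall>y\<in>?I. ?g y = 0"
    using integral_eq_0_iff[OF g] d(1) I(1) \<eta>(1) by (simp add: less_imp_le)
  then have "?g x = 0" using d(1) by (elim bspec) simp
  moreover have "0 < tf_apply \<eta> x" using \<eta>(2)[of x] d(1) by simp
  ultimately show False using nz by simp
qed

section \<open>An entire solution of the scalar equation\<close>

text \<open>The derivatives at \<open>0\<close> of the solution of \<open>Q(D) h = 0\<close> with the initial values of a fundamental
solution: the equation and its derivatives determine them from the first \<open>degree Q\<close> of them.\<close>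

fun recurrence_seq :: "real poly \<Rightarrow> nat \<Rightarrow> real" where
  "recurrence_seq Q k =
    (if Suc k < degree Q then 0 else if Suc k = degree Q then 1 / lead_coeff Q
     else - (\<Sum>j<degree Q. coeff Q j * recurrence_seq Q (k - degree Q + j)) / lead_coeff Q)"

declare recurrence_seq.simps [simp del]

lemma recurrence_seq_sum:
  assumes "Q \<noteq> 0"
  shows "(\<Sum>j\<le>degree Q. coeff Q j * recurrence_seq Q (k + j)) = 0"
proof -
  have "recurrence_seq Q (k + degree Q)
      = - (\<Sum>j<degree Q. coeff Q j * recurrence_seq Q (k + j)) / lead_coeff Q"
    by (subst recurrence_seq.simps) simp
  then show ?thesis
    using assms by (simp add: lessThan_Suc_atMost[symmetric])
qed

text \<open>Each new term is bounded by \<open>M - 1\<close> times the bound of its predecessors, so growth is at most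
geometric and the exponential generating function is entire.\<close>

lemma recurrence_seq_bound:
  fixes Q :: "real poly"
  defines "M \<equiv> 1 + (\<Sum>j<degree Q. \<bar>coeff Q j / lead_coeff Q\<bar>)"
  shows "\<bar>recurrence_seq Q k\<bar> \<le> \<bar>1 / lead_coeff Q\<bar> * M ^ k"
proof (induction k rule: less_induct)
  case (less k)
  let ?n = "degree Q" and ?C = "\<bar>1 / lead_coeff Q\<bar>"
  have M: "1 \<le> M" unfolding M_def by (simp add: sum_nonneg)
  consider "Suc k < ?n" | "Suc k = ?n" | "?n \<le> k" by linarith
  then show ?case
  proof cases
    case 1
    then show ?thesis using M by (subst recurrence_seq.simps) simp
  next
    case 2
    then show ?thesis
      using mult_left_mono[OF one_le_power[OF M], of ?C k] by (subst recurrence_seq.simps) simp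
  next
    case 3
    have "\<bar>recurrence_seq Q k\<bar>
        = \<bar>\<Sum>j<?n. coeff Q j / lead_coeff Q * recurrence_seq Q (k - ?n + j)\<bar>"
      using 3 by (subst recurrence_seq.simps) (simp add: sum_divide_distrib)
    also have "\<dots> \<le> (\<Sum>j<?n. \<bar>coeff Q j / lead_coeff Q\<bar> * (?C * M ^ (k - 1)))"
    proof (rule sum_abs[THEN order_trans], rule sum_mono)
      fix j assume j: "j \<in> {..<?n}"
      have "\<bar>recurrence_seq Q (k - ?n + j)\<bar> \<le> ?C * M ^ (k - ?n + j)"
        using 3 j by (intro less) auto
      also have "\<dots> \<le> ?C * M ^ (k - 1)"
        using 3 j M by (intro mult_left_mono power_increasing) auto
      finally show "\<bar>coeff Q j / lead_coeff Q * recurrence_seq Q (k - ?n + j)\<bar>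
          \<le> \<bar>coeff Q j / lead_coeff Q\<bar> * (?C * M ^ (k - 1))"
        by (subst abs_mult) (rule mult_left_mono, simp_all)
    qed
    also have "\<dots> = (M - 1) * (?C * M ^ (k - 1))"
      by (subst sum_distrib_right[symmetric]) (simp add: M_def)
    also have "\<dots> \<le> ?C * M ^ k"
    proof (cases k)
      case 0
      then show ?thesis using 3 by (simp add: M_def)
    next
      case (Suc m)
      have "(M - 1) * (?C * M ^ m) \<le> M * (?C * M ^ m)"
        using M by (intro mult_right_mono) auto
      then show ?thesis using Suc by (simp add: mult_ac)
    qed
    finally show ?thesis .
  qed
qed

text \<open>\<open>H k\<close> is the \<open>k\<close>-th derivative of \<open>H 0\<close>. Differentiating an exponential generating function
shifts its coefficient sequence, so \<open>Q(D)\<close> acts on the coefficients by the recurrence.\<close>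

lemma ex_ode_solution:
  fixes Q :: "real poly"
  assumes Q: "Q \<noteq> 0"
  obtains H :: "nat \<Rightarrow> real \<Rightarrow> real" where
    "\<And>k x. (H k has_real_derivative H (Suc k) x) (at x)"
    "\<And>x. (\<Sum>j\<le>degree Q. coeff Q j * H j x) = 0"
    "\<And>k. Suc k < degree Q \<Longrightarrow> H k 0 = 0"
    "\<And>k. Suc k = degree Q \<Longrightarrow> H k 0 = 1 / lead_coeff Q"
proof -
  let ?c = "recurrence_seq Q"
  define H where "H k x = (\<Sum>m. ?c (k + m) / fact m * x ^ m)" for k x
  obtain C M where CM: "\<And>k. \<bar>?c k\<bar> \<le> C * M ^ k" "0 \<le> C" "1 \<le> M"
    using recurrence_seq_bound[of Q] by (metis abs_ge_zero le_add_same_cancel1 sum_nonneg)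
  have summable: "summable (\<lambda>m. ?c (k + m) / fact m * x ^ m)" for k x
  proof (rule summable_comparison_test')
    show "summable (\<lambda>m. C * M ^ k * (inverse (fact m) * (M * \<bar>x\<bar>) ^ m))"
      by (intro summable_mult summable_exp)
    fix m
    have "norm (?c (k + m) / fact m * x ^ m) = \<bar>?c (k + m)\<bar> * (inverse (fact m) * \<bar>x\<bar> ^ m)"
      by (simp add: abs_mult power_abs divide_inverse)
    also have "\<dots> \<le> C * M ^ (k + m) * (inverse (fact m) * \<bar>x\<bar> ^ m)"
      by (intro mult_right_mono CM(1)) simp
    finally show "norm (?c (k + m) / fact m * x ^ m) \<le> C * M ^ k * (inverse (fact m) * (M * \<bar>x\<bar>) ^ m)"
      by (simp add: power_add power_mult_distrib mult_ac)
  qed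
  have diffs: "diffs (\<lambda>m. ?c (k + m) / fact m) = (\<lambda>m. ?c (Suc k + m) / fact m)" for k
    by (simp add: diffs_def fun_eq_iff fact_Suc del: of_nat_Suc)
  have H0: "H k 0 = ?c k" for k
    unfolding H_def using powser_zero[of "\<lambda>m. ?c (k + m) / fact m"] by simp
  show ?thesis
  proof (rule that)
    show "(H k has_real_derivative H (Suc k) x) (at x)" for k x
      using termdiffs_strong_converges_everywhere[OF summable[of k], of x]
      unfolding diffs H_def[abs_def] .
    show "(\<Sum>j\<le>degree Q. coeff Q j * H j x) = 0" for x
    proof -
      have "(\<Sum>j\<le>degree Q. coeff Q j * H j x)
          = (\<Sum>m. \<Sum>j\<le>degree Q. coeff Q j * (?c (j + m) / fact m * x ^ m))"
        unfolding H_def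
        by (simp only: suminf_sum[OF summable_mult[OF summable]] suminf_mult[OF summable])
      also have "\<dots> = (\<Sum>m. (\<Sum>j\<le>degree Q. coeff Q j * ?c (m + j)) * (x ^ m / fact m))"
        by (intro arg_cong[where f = suminf] ext, subst sum_distrib_right, intro sum.cong)
          (simp_all add: add.commute)
      finally show ?thesis by (simp add: recurrence_seq_sum[OF Q])
    qed
    show "H k 0 = 0" if "Suc k < degree Q" for k
      unfolding H0 using that by (subst recurrence_seq.simps) simp
    show "H k 0 = 1 / lead_coeff Q" if "Suc k = degree Q" for k
      unfolding H0 using that by (subst recurrence_seq.simps) simp
  qed
qed

lemma odo_linear: "linear (odo p)"
proof (rule linearI)
  show "odo p (S + T) = odo p S + odo p T" for S T
    by (induction p) (simp_all add: odo_0 odo_pCons linear_add[OF dist_deriv_linear] scaleR_add_right)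
  show "odo p (c *\<^sub>R T) = c *\<^sub>R odo p T" for c T
    by (induction p) (simp_all add: odo_0 odo_pCons linear_scale[OF dist_deriv_linear] scaleR_add_right)
qed

lemma odo_fun_dist:
  assumes D: "\<And>k x. (F k has_real_derivative F (Suc k) x) (at x)"
  shows "odo q (fun_dist (F 0)) = fun_dist (\<lambda>x. \<Sum>k\<le>degree q. coeff q k * F k x)"
proof -
  have F: "continuous_on UNIV (F k)" for k
    using D by (intro continuous_at_imp_continuous_on ballI DERIV_isCont)
  have "(dist_deriv ^^ k) (fun_dist (F 0)) = fun_dist (F k)" for k
    by (induction k) (simp_all add: dist_deriv_fun_dist[OF D F])
  then show ?thesis
    unfolding odo_def using fun_dist_cmult[OF continuous_locally_integrable[OF F]]
      fun_dist_sum[of "{..degree q}" "\<lambda>k x. coeff q k * F k x"] by simp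
qed

text \<open>With these initial values the derivatives of the cut-off function of order below \<open>degree Q\<close> carry no
point mass, and the one of order \<open>degree Q\<close> carries the mass \<open>- 1 / lead_coeff Q\<close>.\<close>

lemma odo_cutoff:
  assumes D: "\<And>k x. (F k has_real_derivative F (Suc k) x) (at x)"
    and zero: "\<And>x. (\<Sum>j\<le>degree Q. coeff Q j * F j x) = 0"
    and init: "\<And>k. Suc k < degree Q \<Longrightarrow> F k 0 = 0"
      "\<And>k. Suc k = degree Q \<Longrightarrow> F k 0 = 1 / lead_coeff Q"
    and deg: "0 < degree Q"
  shows "odo Q (fun_dist (\<lambda>x. F 0 x * indicator {..<0} x)) = - dirac"
proof -
  let ?T = "\<lambda>k. fun_dist (\<lambda>x. F k x * indicator {..<0} x)"
  have F: "continuous_on UNIV (F k)" for k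
    using D by (intro continuous_at_imp_continuous_on ballI DERIV_isCont)
  have "(dist_deriv ^^ k) (?T 0) = ?T k" if "k < degree Q" for k
    using that by (induction k) (simp_all add: dist_deriv_cutoff[OF D F] init(1))
  then have low: "(\<Sum>k<degree Q. coeff Q k *\<^sub>R (dist_deriv ^^ k) (?T 0))
      = (\<Sum>k<degree Q. coeff Q k *\<^sub>R ?T k)"
    by (intro sum.cong) simp_all
  obtain n where n: "degree Q = Suc n" using deg by (cases "degree Q") auto
  have "(dist_deriv ^^ degree Q) (?T 0) = dist_deriv (?T n)"
    using \<open>\<And>k. k < degree Q \<Longrightarrow> (dist_deriv ^^ k) (?T 0) = ?T k\<close>[of n] by (simp add: n)
  also have "\<dots> = ?T (degree Q) - (1 / lead_coeff Q) *\<^sub>R dirac"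
    using init(2)[of n] by (simp add: dist_deriv_cutoff[OF D F] n)
  finally have top: "lead_coeff Q *\<^sub>R (dist_deriv ^^ degree Q) (?T 0)
      = lead_coeff Q *\<^sub>R ?T (degree Q) - dirac"
    using deg by (auto simp: scaleR_diff_right)
  have "odo Q (?T 0) = (\<Sum>k\<le>degree Q. coeff Q k *\<^sub>R ?T k) - dirac"
    unfolding odo_def by (simp add: lessThan_Suc_atMost[symmetric] low top)
  also have "(\<Sum>k\<le>degree Q. coeff Q k *\<^sub>R ?T k)
      = fun_dist (\<lambda>x. \<Sum>k\<le>degree Q. coeff Q k * (F k x * indicator {..<0} x))"
    using fun_dist_cmult[OF locally_integrable_cutoff[OF F]]
      fun_dist_sum[of "{..degree Q}" "\<lambda>k x. coeff Q k * (F k x * indicator {..<0} x)"] by simp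
  also have "(\<lambda>x. \<Sum>k\<le>degree Q. coeff Q k * (F k x * indicator {..<0} x)) = (\<lambda>x. 0)"
    using zero by (simp add: sum_distrib_right[symmetric] mult.assoc[symmetric])
  finally show ?thesis by (simp add: fun_dist_zero)
qed

section \<open>Fundamental solutions and parametrices\<close>

lemma dist_deriv_odo: "dist_deriv (odo q T) = odo q (dist_deriv T)"
  by (induction q) (simp_all add: odo_0 odo_pCons linear_0[OF dist_deriv_linear]
      linear_add[OF dist_deriv_linear] linear_scale[OF dist_deriv_linear])

lemma dist_supported_in_add:
  "dist_supported_in S A \<Longrightarrow> dist_supported_in T A \<Longrightarrow> dist_supported_in (S + T) A"
  by (simp add: dist_supported_in_def dist_apply_arith)

lemma dist_supported_in_diff:
  "dist_supported_in S A \<Longrightarrow> dist_supported_in T A \<Longrightarrow> dist_supported_in (S - T) A"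
  by (simp add: dist_supported_in_def dist_apply_arith)

lemma dist_supported_in_scaleR: "dist_supported_in T A \<Longrightarrow> dist_supported_in (c *\<^sub>R T) A"
  by (simp add: dist_supported_in_def dist_apply_arith)

lemma dist_supported_in_zero: "dist_supported_in 0 A"
  by (simp add: dist_supported_in_def dist_apply_arith)

lemma dist_supported_in_sum:
  "(\<And>i. i \<in> I \<Longrightarrow> dist_supported_in (T i) A) \<Longrightarrow> dist_supported_in (\<Sum>i\<in>I. T i) A"
  by (simp add: dist_supported_in_def dist_apply_arith)

lemma dist_supported_in_deriv: "dist_supported_in T A \<Longrightarrow> dist_supported_in (dist_deriv T) A"
  unfolding dist_supported_in_def dist_deriv.rep_eq using tf_support_deriv by fastforce

lemma dist_supported_in_odo: "dist_supported_in T A \<Longrightarrow> dist_supported_in (odo q T) A"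
  by (induction q) (auto simp: odo_0 odo_pCons
      intro: dist_supported_in_zero dist_supported_in_add dist_supported_in_scaleR dist_supported_in_deriv)

lemma dist_supported_in_dirac: "0 \<in> A \<Longrightarrow> dist_supported_in dirac A"
  using tf_zero_outside[OF order_refl] by (force simp: dist_supported_in_def dirac.rep_eq)

lemma dist_supported_in_fun_dist:
  assumes "\<And>x. x \<notin> A \<Longrightarrow> f x = 0"
  shows "dist_supported_in (fun_dist f) A"
proof -
  have "(LINT x|lborel. f x * tf_apply \<phi> x) = 0" if "tf_support \<phi> \<inter> A = {}" for \<phi>
  proof -
    have "f x * tf_apply \<phi> x = 0" for x
      using assms[of x] tf_zero_outside[OF order_refl, of x \<phi>] that by (cases "x \<in> A") auto
    then show ?thesis by (simp only: integral_zero)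
  qed
  then show ?thesis by (simp add: dist_supported_in_def fun_dist.rep_eq)
qed

text \<open>The derivative of minus the left half of the entire solution for \<open>D Q\<close>.\<close>

lemma ex_anticausal_fundamental_solution:
  assumes "Q \<noteq> 0"
  obtains g where "odo Q g = dirac" "dist_supported_in g {..0}"
proof -
  \<comment> \<open>The additional factor \<open>D\<close> makes the degree positive also for constant \<open>Q\<close>;
  it is removed by differentiating the result.\<close>
  let ?Q = "pCons 0 Q"
  have Q: "?Q \<noteq> 0" "0 < degree ?Q" using assms by auto
  obtain H :: "nat \<Rightarrow> real \<Rightarrow> real" where H:
    "\<And>k x. (H k has_real_derivative H (Suc k) x) (at x)"
    "\<And>x. (\<Sum>j\<le>degree ?Q. coeff ?Q j * H j x) = 0"
    "\<And>k. Suc k < degree ?Q \<Longrightarrow> H k 0 = 0"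
    "\<And>k. Suc k = degree ?Q \<Longrightarrow> H k 0 = 1 / lead_coeff ?Q"
    by (rule ex_ode_solution[OF Q(1)]) (rule that)
  let ?T = "- fun_dist (\<lambda>x. H 0 x * indicator {..<0} x)"
  have "odo Q (dist_deriv ?T) = odo ?Q ?T"
    by (simp add: odo_pCons dist_deriv_odo)
  also have "\<dots> = dirac"
    using odo_cutoff[OF H Q(2)] by (simp add: linear_neg[OF odo_linear])
  finally show ?thesis
    by (rule that) (unfold uminus_distribution_def,
        intro dist_supported_in_deriv dist_supported_in_scaleR dist_supported_in_fun_dist, auto)
qed

text \<open>With the entire solution \<open>h\<close> for \<open>D Q\<close> and a smooth step \<open>\<kappa>\<close> from \<open>1\<close> to \<open>0\<close> on \<open>[0, 1]\<close>, the function
\<open>S = \<kappa> h - h 1\<^bsub>x<0\<^esub>\<close> is supported in \<open>[0, 1]\<close>. The operator \<open>D Q\<close> turns the cut-off part into \<open>\<delta>\<close>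
and \<open>\<kappa> h\<close> into a smooth function, which vanishes where \<open>\<kappa>\<close> is constant; so \<open>T\<close> is the derivative of \<open>S\<close>.\<close>

lemma ex_parametrix:
  assumes "Q \<noteq> 0"
  obtains T \<psi> where "dist_compact_support T" "odo Q T = dirac - fun_dist (tf_apply \<psi>)"
proof -
  let ?Q = "pCons 0 Q"
  have Q: "?Q \<noteq> 0" "0 < degree ?Q" using assms by auto
  obtain H :: "nat \<Rightarrow> real \<Rightarrow> real" where H:
    "\<And>k x. (H k has_real_derivative H (Suc k) x) (at x)"
    "\<And>x. (\<Sum>j\<le>degree ?Q. coeff ?Q j * H j x) = 0"
    "\<And>k. Suc k < degree ?Q \<Longrightarrow> H k 0 = 0"
    "\<And>k. Suc k = degree ?Q \<Longrightarrow> H k 0 = 1 / lead_coeff ?Q"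
    by (rule ex_ode_solution[OF Q(1)]) (rule that)
  have sm_H: "smooth (H 0)" and H_deriv: "\<And>k. (deriv ^^ k) (H 0) = H k"
    using smooth_chainI[of H "H 0"] H(1) by auto
  obtain \<kappa> :: "real \<Rightarrow> real" where \<kappa>: "smooth \<kappa>" "\<And>x. x \<le> 0 \<Longrightarrow> \<kappa> x = 1" "\<And>x. 1 \<le> x \<Longrightarrow> \<kappa> x = 0"
    by (rule ex_smooth_step) (rule that)
  let ?f = "\<lambda>x. \<kappa> x * H 0 x"
  let ?g = "\<lambda>x. \<Sum>k\<le>degree ?Q. coeff ?Q k * (deriv ^^ k) ?f x"
  have sm_f: "smooth ?f" by (intro smooth_mult \<kappa>(1) sm_H)
  have sm_g: "smooth ?g" by (intro smooth_sum smooth_cmult(1) smooth_deriv_funpow sm_f)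
  have g_zero: "x \<in> {0..1}" if "?g x \<noteq> 0" for x
  proof (rule ccontr)
    assume "x \<notin> {0..1}"
    then consider "x < 0" | "1 < x" by fastforce
    then have "?g x = 0"
    proof cases
      case 1
      have "\<forall>\<^sub>F y in nhds x. y \<in> {..<0}" using 1 by (intro eventually_nhds_in_open) auto
      then have "\<forall>\<^sub>F y in nhds x. ?f y = H 0 y" by eventually_elim (simp add: \<kappa>(2))
      then have "(deriv ^^ k) ?f x = H k x" for k
        using higher_deriv_cong_ev[of ?f "H 0" x x k] by (simp add: H_deriv)
      then show ?thesis using H(2)[of x] by simp
    next
      case 2
      have "fun_support ?f \<subseteq> {..1}"
      proof (rule fun_support_leI)
        show "y \<in> {..1}" if "?f y \<noteq> 0" for y
          using that \<kappa>(3)[of y] by (cases "1 \<le> y") auto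
      qed simp
      then have "x \<notin> fun_support ?f" using 2 by auto
      then have "(deriv ^^ k) ?f x = 0" for k by (rule deriv_zero_off_support)
      then show ?thesis by (simp only: mult_zero_right sum.neutral_const)
    qed
    with that show False by contradiction
  qed
  define \<theta> where "\<theta> = Abs_test_fun ?g"
  have "compact (fun_support ?g)" using g_zero by (rule compact_fun_supportI) simp_all
  then have \<theta>: "tf_apply \<theta> = ?g"
    unfolding \<theta>_def using sm_g by (intro Abs_test_fun_inverse) simp
  let ?S = "fun_dist ?f - fun_dist (\<lambda>x. H 0 x * indicator {..<0} x)"
  have "odo Q (dist_deriv ?S) = odo ?Q ?S"
    by (simp add: odo_pCons dist_deriv_odo)
  also have "\<dots> = fun_dist ?g + dirac"
    using odo_cutoff[OF H Q(2)] odo_fun_dist[of "\<lambda>k. (deriv ^^ k) ?f" ?Q] smooth_DERIV[OF sm_f]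
    by (simp add: linear_diff[OF odo_linear])
  also have "\<dots> = dirac - (- 1) *\<^sub>R fun_dist (tf_apply \<theta>)"
    by (simp add: \<theta>)
  also have "(- 1) *\<^sub>R fun_dist (tf_apply \<theta>) = fun_dist (tf_apply ((- 1) *\<^sub>R \<theta>))"
    by (simp only: scaleR_test_fun.rep_eq fun_dist_cmult(2)[OF tf_locally_integrable])
  finally have "odo Q (dist_deriv ?S) = dirac - fun_dist (tf_apply ((- 1) *\<^sub>R \<theta>))" .
  moreover have "?S = fun_dist (\<lambda>x. ?f x - H 0 x * indicator {..<0} x)"
  proof -
    have li: "locally_integrable ?f" "locally_integrable (\<lambda>x. H 0 x * indicator {..<0} x)"
      using sm_f sm_H by (auto intro!: continuous_locally_integrable locally_integrable_cutoff
          smooth_imp_continuous_on)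
    show ?thesis by (rule fun_dist_diff[OF li, symmetric])
  qed
  moreover have "dist_supported_in (fun_dist (\<lambda>x. ?f x - H 0 x * indicator {..<0} x)) {0..1}"
    by (rule dist_supported_in_fun_dist) (auto simp: \<kappa> not_le)
  ultimately show ?thesis
    by (intro that) (auto simp: dist_compact_support_def intro: dist_supported_in_deriv)
qed

text \<open>The energy \<open>e = \<Sum> (F\<^sub>k)\<^sup>2\<close> satisfies \<open>\<bar>e'\<bar> \<le> C e\<close>, so \<open>e x * exp (C x)\<close> is nondecreasing. It
is nonnegative and vanishes at \<open>a\<close>, hence everywhere to the left of \<open>a\<close>.\<close>

lemma ode_energy_uniqueness:
  fixes F :: "nat \<Rightarrow> real \<Rightarrow> real"
  assumes D: "\<And>k x. (F k has_real_derivative F (Suc k) x) (at x)"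
    and ode: "\<And>x. F n x = (\<Sum>k<n. b k * F k x)"
    and init: "\<And>k. k < n \<Longrightarrow> F k a = 0" and x: "x \<le> a"
  shows "F 0 x = 0"
proof -
  define e where "e x = (\<Sum>k<n. (F k x)\<^sup>2)" for x
  define e' where "e' x = (\<Sum>k<n. 2 * (F k x * F (Suc k) x))" for x
  define M where "M = 1 + (\<Sum>k<n. \<bar>b k\<bar>)"
  have M: "1 \<le> M" unfolding M_def by (simp add: sum_nonneg)
  have e_nonneg: "0 \<le> e x" for x unfolding e_def by (simp add: sum_nonneg)
  have prod: "\<bar>F i x * F j x\<bar> \<le> e x" if "i < n" "j < n" for i j x
  proof -
    have "(F k x)\<^sup>2 \<le> e x" if "k < n" for k
      unfolding e_def using that by (intro member_le_sum) auto
    then have "\<bar>F k x\<bar> \<le> sqrt (e x)" if "k < n" for k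
      using that by (intro real_le_rsqrt) simp
    then have "\<bar>F i x\<bar> * \<bar>F j x\<bar> \<le> sqrt (e x) * sqrt (e x)"
      using that e_nonneg by (intro mult_mono) auto
    then show ?thesis using e_nonneg[of x] by (simp add: abs_mult)
  qed
  have "\<bar>F k x * F (Suc k) x\<bar> \<le> M * e x" if "k < n" for k x
  proof (cases "Suc k < n")
    case True
    then have "\<bar>F k x * F (Suc k) x\<bar> \<le> 1 * e x" using prod[of k "Suc k"] by simp
    also have "\<dots> \<le> M * e x" using M e_nonneg by (intro mult_right_mono)
    finally show ?thesis .
  next
    case False
    then have "Suc k = n" using that by simp
    then have "\<bar>F k x * F (Suc k) x\<bar> = \<bar>\<Sum>j<n. b j * (F k x * F j x)\<bar>"
      by (simp add: ode sum_distrib_left mult_ac)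
    also have "\<dots> \<le> (\<Sum>j<n. \<bar>b j\<bar> * e x)"
      by (rule order_trans[OF sum_abs]) (auto intro!: sum_mono mult_left_mono prod that simp: abs_mult[of "b _"])
    also have "\<dots> = (M - 1) * e x" by (simp add: M_def sum_distrib_right)
    also have "\<dots> \<le> M * e x" using e_nonneg by (intro mult_right_mono) auto
    finally show ?thesis .
  qed
  note energy_step = this
  have e'_bound: "\<bar>e' x\<bar> \<le> 2 * real n * M * e x" for x
  proof -
    have "\<bar>e' x\<bar> \<le> (\<Sum>k<n. 2 * (M * e x))"
      unfolding e'_def
    proof (rule order_trans[OF sum_abs sum_mono])
      fix k assume "k \<in> {..<n}"
      then show "\<bar>2 * (F k x * F (Suc k) x)\<bar> \<le> 2 * (M * e x)"
        using energy_step[of k x] by (subst abs_mult) simp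
    qed
    then show ?thesis by simp
  qed
  let ?C = "2 * real n * M"
  have De: "(e has_real_derivative e' x) (at x)" for x
    unfolding e_def[abs_def] e'_def
    by (auto intro!: derivative_eq_intros D sum.cong simp: power2_eq_square)
  have "e x * exp (?C * x) \<le> e a * exp (?C * a)"
  proof (rule DERIV_nonneg_imp_nondecreasing[OF x])
    fix y
    have "((\<lambda>y. e y * exp (?C * y)) has_real_derivative (e' y + ?C * e y) * exp (?C * y)) (at y)"
      by (auto intro!: derivative_eq_intros De simp: algebra_simps)
    moreover have "0 \<le> e' y + ?C * e y" using e'_bound[of y] by linarith
    ultimately show "\<exists>d. ((\<lambda>y. e y * exp (?C * y)) has_real_derivative d) (at y) \<and> 0 \<le> d"
      by (auto intro!: exI[of _ "(e' y + ?C * e y) * exp (?C * y)"])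
  qed
  moreover have "e a = 0" unfolding e_def by (simp add: init)
  ultimately have "e x = 0" using e_nonneg[of x] by (simp add: mult_le_0_iff)
  then show ?thesis
  proof (cases n)
    case (Suc m)
    then have "(F 0 x)\<^sup>2 \<le> e x" unfolding e_def by (intro member_le_sum) auto
    then show ?thesis using \<open>e x = 0\<close> by simp
  qed (use ode[of x] in simp)
qed

section \<open>Uniqueness of causal solutions\<close>

lemma dist_apply_deriv_pow:
  "dist_apply ((dist_deriv ^^ k) T) \<phi> = (- 1) ^ k * dist_apply T ((tf_deriv ^^ k) \<phi>)"
  by (induction k arbitrary: \<phi>) (simp_all add: dist_deriv.rep_eq funpow_swap1[of tf_deriv])

lemma tf_deriv_shift: "tf_deriv (tf_shift a \<phi>) = tf_shift a (tf_deriv \<phi>)"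
  using higher_deriv_tf_shift[of 1 a \<phi>]
  by (intro tf_eqI) (simp add: tf_deriv.rep_eq tf_shift.rep_eq)

lemma tf_deriv_pow_shift: "(tf_deriv ^^ k) (tf_shift a \<phi>) = tf_shift a ((tf_deriv ^^ k) \<phi>)"
  by (induction k) (simp_all add: tf_deriv_shift)

text \<open>For a test function \<open>\<eta>\<close> the function \<open>x \<mapsto> \<langle>T, \<eta>(x + \<cdot>)\<rangle>\<close> is smooth, solves a scalar equation
and vanishes for large \<open>x\<close>, since then \<open>\<eta>(x + \<cdot>)\<close> lives on the negative axis. By uniqueness for
classical solutions it is zero, in particular at \<open>x = 0\<close>.\<close>

lemma causal_solution_unique:
  assumes Q: "Q \<noteq> 0" and null: "odo Q T = 0" and causal: "dist_supported_in T {0..}"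
  shows "T = 0"
proof (rule dist_eqI)
  fix \<eta>
  define F where "F k x = dist_apply T (tf_shift x ((tf_deriv ^^ k) \<eta>))" for k x
  let ?n = "degree Q"
  let ?c = "\<lambda>k. coeff Q k * (- 1) ^ k"
  have lead: "?c ?n \<noteq> 0" using Q by simp
  obtain s where s: "0 < s" "tf_support \<eta> \<subseteq> {- s..s}"
    using compact_real_subset_interval[OF tf_compact] by blast
  have "F 0 0 = 0"
  proof (rule ode_energy_uniqueness[of F ?n "\<lambda>k. - ?c k / ?c ?n" "s + 1"])
    show "(F k has_real_derivative F (Suc k) x) (at x)" for k x
      using dist_shift_has_derivative[of T "(tf_deriv ^^ k) \<eta>" x] by (simp add: F_def[abs_def])
    show "F ?n x = (\<Sum>k<?n. - ?c k / ?c ?n * F k x)" for x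
    proof -
      have "0 = dist_apply (odo Q T) (tf_shift x \<eta>)" by (simp add: null dist_apply_arith)
      also have "\<dots> = (\<Sum>k\<le>?n. ?c k * F k x)"
        by (simp add: odo_def dist_apply_arith dist_apply_deriv_pow tf_deriv_pow_shift F_def mult.assoc)
      finally have "?c ?n * F ?n x = - (\<Sum>k<?n. ?c k * F k x)"
        by (simp add: lessThan_Suc_atMost[symmetric])
      then have "F ?n x = - (\<Sum>k<?n. ?c k * F k x) / ?c ?n"
        using lead by (simp add: field_simps)
      then show ?thesis by (simp add: sum_divide_distrib sum_negf)
    qed
    \<comment> \<open>The translate by \<open>s + 1\<close> is supported strictly to the left of \<open>0\<close>.\<close>
    show "F k (s + 1) = 0" for k
    proof -
      have "tf_support ((tf_deriv ^^ k) \<eta>) \<subseteq> {- s..s}" using s(2) tf_support_deriv_pow by blast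
      from tf_support_shift[OF this, of "s + 1"]
      have "tf_support (tf_shift (s + 1) ((tf_deriv ^^ k) \<eta>)) \<inter> {0..} = {}" by fastforce
      then show ?thesis using causal by (simp add: F_def dist_supported_in_def)
    qed
    show "0 \<le> s + 1" using s(1) by simp
  qed
  moreover have "tf_shift 0 \<eta> = \<eta>" by (rule tf_eqI) (simp add: tf_shift.rep_eq)
  ultimately show "dist_apply T \<eta> = dist_apply 0 \<eta>" by (simp add: F_def dist_apply_arith)
qed

section \<open>Adjugate matrices and adjoint operators\<close>

text \<open>Column \<open>c\<close> of the adjugate consists of the determinants of \<open>L\<close> with row \<open>c\<close> replaced by a unit
vector. Expanding by linearity in that row gives \<open>det L\<close>, or a determinant with two equal rows.\<close>

lemma ex_right_adjugate:
  fixes L :: "'a::comm_ring_1 ^ 'n::finite ^ 'n"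
  obtains A :: "'a ^ 'n ^ 'n" where
    "\<And>r c. (\<Sum>k\<in>UNIV. L $ r $ k * A $ k $ c) = (if r = c then det L else 0)"
proof -
  define A :: "'a ^ 'n ^ 'n" where "A = (\<chi> k c. det (\<chi> i. if i = c then axis k 1 else L $ i))"
  have "(\<Sum>k\<in>UNIV. L $ r $ k * A $ k $ c) = (if r = c then det L else 0)" for r c
  proof -
    have "(\<Sum>k\<in>UNIV. L $ r $ k * A $ k $ c)
        = det (\<chi> i. if i = c then \<Sum>k\<in>UNIV. L $ r $ k *s axis k 1 else L $ i)"
      by (simp add: A_def det_linear_row_sum det_row_mul)
    also have "(\<Sum>k\<in>UNIV. L $ r $ k *s axis k 1) = L $ r"
      by (rule basis_expansion)
    also have "det (\<chi> i. if i = c then L $ r else L $ i) = (if r = c then det L else 0)"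
    proof (cases "r = c")
      case True
      then have "(\<chi> i. if i = c then L $ r else L $ i) = L" by (simp add: vec_eq_iff)
      with True show ?thesis by simp
    next
      case False
      then show ?thesis
        using det_identical_rows[of r c "\<chi> i. if i = c then L $ r else L $ i"] by (simp add: row_def)
    qed
    finally show ?thesis .
  qed
  then show ?thesis by (rule that)
qed

lemma ex_left_adjugate:
  fixes L :: "'a::comm_ring_1 ^ 'n::finite ^ 'n"
  obtains B :: "'a ^ 'n ^ 'n" where
    "\<And>r c. (\<Sum>k\<in>UNIV. B $ r $ k * L $ k $ c) = (if r = c then det L else 0)"
proof -
  obtain A :: "'a ^ 'n ^ 'n" where A:
    "\<And>r c. (\<Sum>k\<in>UNIV. transpose L $ r $ k * A $ k $ c) = (if r = c then det (transpose L) else 0)"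
    using ex_right_adjugate[of "transpose L"] by metis
  show ?thesis
    by (rule that[of "transpose A"]) (use A in \<open>simp only: det_transpose, simp add: transpose_def mult.commute\<close>)
qed

lemma odo_sum: "odo (\<Sum>i\<in>I. p i) T = (\<Sum>i\<in>I. odo (p i) T)"
  by (induction I rule: infinite_finite_induct) (simp_all add: odo_0 odo_add)

lemma poly_odo_adjoint: "poly (odo_adjoint p) x = poly p (- x)"
  by (simp add: odo_adjoint_def poly_sum poly_monom poly_altdef[of p] power_minus[of x] mult_ac)

lemma odo_adjoint_mult: "odo_adjoint (p * q) = odo_adjoint p * odo_adjoint q"
  by (simp add: poly_eq_poly_eq_iff[symmetric] fun_eq_iff poly_odo_adjoint)

lemma odo_adjoint_sum: "odo_adjoint (\<Sum>i\<in>I. p i) = (\<Sum>i\<in>I. odo_adjoint (p i))"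
  by (simp add: poly_eq_poly_eq_iff[symmetric] fun_eq_iff poly_odo_adjoint poly_sum)

lemma odo_adjoint_pCons: "odo_adjoint (pCons a p) = pCons a (- odo_adjoint p)"
  by (simp add: poly_eq_poly_eq_iff[symmetric] fun_eq_iff poly_odo_adjoint)

lemma odo_adjoint_involutive: "odo_adjoint (odo_adjoint q) = q"
  by (rule poly_eqI) (simp add: coeff_odo_adjoint flip: mult.assoc power_mult_distrib)

lemma odo_adjoint_0: "odo_adjoint 0 = 0"
  by (simp add: odo_adjoint_def)

lemma odo_adjoint_eq_0_iff: "odo_adjoint p = 0 \<longleftrightarrow> p = 0"
  by (auto simp: poly_eq_iff coeff_odo_adjoint)

lemma odo_minus: "odo (- p) T = - odo p T"
  using odo_smult[of "-1" p T] by simp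

lemma dist_reflect_linear: "linear dist_reflect"
  by (rule linearI) (auto intro!: dist_eqI simp: dist_reflect.rep_eq dist_apply_arith)

lemma tf_deriv_reflect: "tf_deriv (tf_reflect \<phi>) = - tf_reflect (tf_deriv \<phi>)"
  using smooth_reflect(2)[OF tf_smooth, of 1 \<phi>]
  by (intro tf_eqI) (simp add: tf_apply_minus tf_deriv.rep_eq tf_reflect.rep_eq)

lemma dist_reflect_deriv: "dist_reflect (dist_deriv T) = - dist_deriv (dist_reflect T)"
  by (rule dist_eqI) (simp add: dist_apply_minus dist_reflect.rep_eq dist_deriv.rep_eq
      tf_deriv_reflect linear_neg[OF dist_linear])

lemma dist_reflect_odo: "dist_reflect (odo q T) = odo (odo_adjoint q) (dist_reflect T)"
  by (induction q)
    (simp_all add: odo_0 odo_pCons odo_adjoint_pCons odo_adjoint_0 odo_minus dist_reflect_deriv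
      linear_0[OF dist_reflect_linear] linear_add[OF dist_reflect_linear]
      linear_scale[OF dist_reflect_linear] linear_neg[OF dist_deriv_linear])

lemma dist_reflect_dirac: "dist_reflect dirac = dirac"
  by (rule dist_eqI) (simp add: dist_reflect.rep_eq dirac.rep_eq tf_reflect.rep_eq)

section \<open>Convolution and differential operators\<close>

lemma dist_compact_support_deriv: "dist_compact_support T \<Longrightarrow> dist_compact_support (dist_deriv T)"
  unfolding dist_compact_support_def using dist_supported_in_deriv by blast

lemma dist_compact_support_odo: "dist_compact_support T \<Longrightarrow> dist_compact_support (odo q T)"
  unfolding dist_compact_support_def using dist_supported_in_odo by blast

lemma dist_supported_in_mono: "dist_supported_in T A \<Longrightarrow> A \<subseteq> B \<Longrightarrow> dist_supported_in T B"
  unfolding dist_supported_in_def by blast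

lemma dist_compact_support_add:
  assumes "dist_compact_support S" "dist_compact_support T"
  shows "dist_compact_support (S + T)"
proof -
  obtain K L where "compact K" "dist_supported_in S K" "compact L" "dist_supported_in T L"
    using assms unfolding dist_compact_support_def by blast
  then have "compact (K \<union> L)" "dist_supported_in (S + T) (K \<union> L)"
    by (auto intro!: dist_supported_in_add intro: dist_supported_in_mono)
  then show ?thesis unfolding dist_compact_support_def by blast
qed

lemma dist_compact_support_zero: "dist_compact_support 0"
  unfolding dist_compact_support_def using dist_supported_in_zero by blast

lemma dist_compact_support_sum:
  "(\<And>i. i \<in> I \<Longrightarrow> dist_compact_support (T i)) \<Longrightarrow> dist_compact_support (\<Sum>i\<in>I. T i)"
  by (induction I rule: infinite_finite_induct)
    (auto intro: dist_compact_support_zero dist_compact_support_add)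

lemma dist_compact_support_scaleR: "dist_compact_support T \<Longrightarrow> dist_compact_support (c *\<^sub>R T)"
  unfolding dist_compact_support_def using dist_supported_in_scaleR by blast

lemma dist_compact_support_dirac: "dist_compact_support dirac"
  unfolding dist_compact_support_def by (intro exI[of _ "{0}"] conjI dist_supported_in_dirac) simp_all

lemma dist_compact_support_test_fun: "dist_compact_support (fun_dist (tf_apply \<psi>))"
  unfolding dist_compact_support_def
  by (intro exI[of _ "tf_support \<psi>"] conjI tf_compact dist_supported_in_fun_dist tf_zero_outside[OF order_refl])

lemma dist_conv_linear_left:
  assumes "dist_compact_support T"
  shows "linear (\<lambda>u. dist_conv u T)"
  by (rule linearI) (auto intro!: dist_eqI simp: dist_apply_dist_conv[OF assms] dist_apply_arith)

lemma dist_conv_add_right: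
  assumes "dist_compact_support S" "dist_compact_support T"
  shows "dist_conv u (S + T) = dist_conv u S + dist_conv u T"
proof (rule dist_eqI)
  fix \<phi>
  have "tf_conv (S + T) \<phi> = tf_conv S \<phi> + tf_conv T \<phi>"
    by (rule tf_eqI) (simp add: tf_apply_tf_conv assms dist_compact_support_add plus_test_fun.rep_eq dist_apply_arith)
  then show "dist_apply (dist_conv u (S + T)) \<phi> = dist_apply (dist_conv u S + dist_conv u T) \<phi>"
    by (simp add: dist_apply_dist_conv assms dist_compact_support_add dist_apply_arith linear_add[OF dist_linear])
qed

lemma dist_conv_scaleR_right:
  assumes "dist_compact_support T"
  shows "dist_conv u (c *\<^sub>R T) = c *\<^sub>R dist_conv u T"
proof (rule dist_eqI)
  fix \<phi>
  have "tf_conv (c *\<^sub>R T) \<phi> = c *\<^sub>R tf_conv T \<phi>"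
    by (rule tf_eqI) (simp add: tf_apply_tf_conv assms dist_compact_support_scaleR scaleR_test_fun.rep_eq dist_apply_arith)
  then show "dist_apply (dist_conv u (c *\<^sub>R T)) \<phi> = dist_apply (c *\<^sub>R dist_conv u T) \<phi>"
    by (simp add: dist_apply_dist_conv assms dist_compact_support_scaleR dist_apply_arith linear_scale[OF dist_linear])
qed

lemma dist_conv_zero_right: "dist_conv u 0 = 0"
  using dist_conv_scaleR_right[OF dist_compact_support_zero, of u 0] by simp

lemma tf_deriv_conv:
  assumes "dist_compact_support T"
  shows "tf_deriv (tf_conv T \<phi>) = tf_conv T (tf_deriv \<phi>)"
  using dist_shift_smooth(2)[of 1 T \<phi>]
  by (intro tf_eqI) (simp add: tf_deriv.rep_eq tf_apply_tf_conv[OF assms])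

lemma dist_conv_deriv_left:
  assumes "dist_compact_support T"
  shows "dist_conv (dist_deriv u) T = dist_deriv (dist_conv u T)"
  by (rule dist_eqI) (simp add: dist_apply_dist_conv[OF assms] dist_deriv.rep_eq tf_deriv_conv[OF assms])

lemma dist_conv_deriv_right:
  assumes "dist_compact_support T"
  shows "dist_conv u (dist_deriv T) = dist_deriv (dist_conv u T)"
proof (rule dist_eqI)
  fix \<phi>
  have "tf_conv (dist_deriv T) \<phi> = - tf_conv T (tf_deriv \<phi>)"
    by (rule tf_eqI) (simp add: tf_apply_tf_conv assms dist_compact_support_deriv tf_apply_minus
        dist_deriv.rep_eq tf_deriv_shift)
  then show "dist_apply (dist_conv u (dist_deriv T)) \<phi> = dist_apply (dist_deriv (dist_conv u T)) \<phi>"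
    by (simp add: dist_apply_dist_conv assms dist_compact_support_deriv dist_deriv.rep_eq linear_neg[OF dist_linear])
qed

text \<open>Together with \<open>dist_conv_odo_right\<close>, this lets an operator move from one factor of a convolution
to the other.\<close>

lemma dist_conv_odo_left:
  assumes "dist_compact_support T"
  shows "dist_conv (odo q u) T = odo q (dist_conv u T)"
  by (induction q)
    (simp_all add: odo_0 odo_pCons dist_conv_deriv_left[OF assms] linear_0[OF dist_conv_linear_left[OF assms]]
      linear_add[OF dist_conv_linear_left[OF assms]] linear_scale[OF dist_conv_linear_left[OF assms]])

lemma dist_conv_odo_right:
  assumes "dist_compact_support T"
  shows "dist_conv u (odo q T) = odo q (dist_conv u T)"
  by (induction q)
    (simp_all add: odo_0 odo_pCons dist_conv_deriv_right dist_conv_zero_right dist_conv_add_right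
      dist_conv_scaleR_right assms dist_compact_support_odo dist_compact_support_deriv dist_compact_support_scaleR)

lemma dist_conv_dirac: "dist_conv u dirac = u"
proof (rule dist_eqI)
  fix \<phi>
  have "tf_conv dirac \<phi> = \<phi>"
    by (rule tf_eqI) (simp add: tf_apply_tf_conv dist_compact_support_dirac dirac.rep_eq tf_shift.rep_eq)
  then show "dist_apply (dist_conv u dirac) \<phi> = dist_apply u \<phi>"
    by (simp add: dist_apply_dist_conv dist_compact_support_dirac)
qed

lemma dist_compact_support_conv:
  assumes u: "dist_compact_support u" and T: "dist_compact_support T"
  shows "dist_compact_support (dist_conv u T)"
proof -
  obtain r where r: "0 < r" "\<And>\<psi>. tf_support \<psi> \<inter> {- r..r} = {} \<Longrightarrow> dist_apply u \<psi> = 0"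
    using dist_compact_supportE[OF u] by blast
  obtain s where s: "0 < s" "\<And>\<psi>. tf_support \<psi> \<inter> {- s..s} = {} \<Longrightarrow> dist_apply T \<psi> = 0"
    using dist_compact_supportE[OF T] by blast
  let ?K = "{- (r + 1 + s)..r + 1 + s}"
  have "dist_apply (dist_conv u T) \<phi> = 0" if \<phi>: "tf_support \<phi> \<inter> ?K = {}" for \<phi>
  proof -
    have "x \<in> - {- r - 1<..<r + 1}" if "tf_apply (tf_conv T \<phi>) x \<noteq> 0" for x
    proof (rule ccontr)
      assume x: "x \<notin> - {- r - 1<..<r + 1}"
      have "tf_support (tf_shift x \<phi>) \<subseteq> (\<lambda>y. x + y) -` tf_support \<phi>"
      proof (rule fun_support_leI)
        show "closed ((\<lambda>y. x + y) -` tf_support \<phi>)"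
          by (intro continuous_closed_vimage closed_fun_support continuous_intros)
      qed (use fun_support_in in \<open>auto simp: tf_shift.rep_eq\<close>)
      then have "tf_support (tf_shift x \<phi>) \<inter> {- s..s} = {}"
        using \<phi> x by fastforce
      then have "tf_apply (tf_conv T \<phi>) x = 0" by (simp add: tf_apply_tf_conv[OF T] s(2))
      with that show False by contradiction
    qed
    then have "tf_support (tf_conv T \<phi>) \<subseteq> - {- r - 1<..<r + 1}"
      by (rule fun_support_leI) auto
    then have "tf_support (tf_conv T \<phi>) \<inter> {- r..r} = {}" by fastforce
    then show ?thesis by (simp add: dist_apply_dist_conv[OF T] r(2))
  qed
  then show ?thesis unfolding dist_compact_support_def dist_supported_in_def by blast
qed

section \<open>Regularisation by test functions\<close>

text \<open>This is the convolution of the reflection of \<open>u\<close> with \<open>\<phi>\<close>. It extends \<open>tf_conv\<close> to all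
distributions, with values that are smooth functions but in general have no compact support.\<close>

definition correlation :: "distribution \<Rightarrow> test_fun \<Rightarrow> real \<Rightarrow> real" where
  "correlation u \<phi> x = dist_apply u (tf_shift x \<phi>)"

lemma smooth_correlation: "smooth (correlation u \<phi>)"
  unfolding correlation_def[abs_def] by (rule dist_shift_smooth(1))

lemma correlation_has_derivative:
  "(correlation u \<phi> has_real_derivative - correlation (dist_deriv u) \<phi> x) (at x)"
  using dist_shift_has_derivative[of u \<phi> x]
  by (simp add: correlation_def[abs_def] dist_deriv.rep_eq tf_deriv_shift)

lemma locally_integrable_correlation: "locally_integrable (correlation u \<phi>)"
  by (intro continuous_locally_integrable smooth_imp_continuous_on smooth_correlation)

lemma correlation_linear: "linear (\<lambda>u. fun_dist (correlation u \<phi>))"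
proof (rule linearI)
  show "fun_dist (correlation (u + w) \<phi>) = fun_dist (correlation u \<phi>) + fun_dist (correlation w \<phi>)" for u w
    using fun_dist_add(2)[OF locally_integrable_correlation locally_integrable_correlation, of u \<phi> w \<phi>]
    by (simp add: correlation_def[abs_def] dist_apply_arith)
  show "fun_dist (correlation (c *\<^sub>R u) \<phi>) = c *\<^sub>R fun_dist (correlation u \<phi>)" for c u
    using fun_dist_cmult(2)[OF locally_integrable_correlation, of c u \<phi>]
    by (simp add: correlation_def[abs_def] dist_apply_arith)
qed

lemma odo_correlation:
  "odo q (fun_dist (correlation u \<phi>)) = fun_dist (correlation (odo (odo_adjoint q) u) \<phi>)"
proof (induction q)
  case 0
  then show ?case by (simp add: odo_0 odo_adjoint_0 linear_0[OF correlation_linear])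
next
  case (pCons a q)
  have "dist_deriv (fun_dist (correlation w \<phi>)) = fun_dist (correlation (- dist_deriv w) \<phi>)" for w
  proof -
    have "correlation (- dist_deriv w) \<phi> = (\<lambda>x. - correlation (dist_deriv w) \<phi> x)"
      by (simp add: correlation_def fun_eq_iff dist_apply_minus)
    then show ?thesis
      using smooth_imp_continuous_on[OF smooth_correlation]
      by (simp add: dist_deriv_fun_dist[OF correlation_has_derivative] continuous_on_minus)
  qed
  then show ?case
    by (simp add: odo_pCons odo_adjoint_pCons pCons.IH odo_minus linear_add[OF correlation_linear]
        linear_scale[OF correlation_linear] linear_neg[OF dist_deriv_linear] linear_neg[OF correlation_linear] linear_diff[OF correlation_linear])
qed

lemma correlation_dirac: "correlation dirac \<phi> = tf_apply \<phi>"
  by (simp add: fun_eq_iff correlation_def dirac.rep_eq tf_shift.rep_eq)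

lemma dist_reflect_fun_dist:
  assumes "continuous_on UNIV f"
  shows "dist_reflect (fun_dist f) = fun_dist (\<lambda>x. f (- x))"
proof (rule dist_eqI)
  fix \<phi>
  have "continuous_on UNIV (\<lambda>x. f (- x))"
    by (intro continuous_on_compose2[OF assms] continuous_intros) auto
  then have li: "locally_integrable (\<lambda>x. f (- x))" by (rule continuous_locally_integrable)
  have "(LINT x|lborel. f x * tf_apply \<phi> (- x)) = (LINT x|lborel. f (- x) * tf_apply \<phi> x)"
    by (subst lborel_integral_real_affine[of "- 1" _ 0]) simp_all
  then show "dist_apply (dist_reflect (fun_dist f)) \<phi> = dist_apply (fun_dist (\<lambda>x. f (- x))) \<phi>"
    by (simp add: dist_reflect.rep_eq dist_apply_fun_dist li continuous_locally_integrable assms tf_reflect.rep_eq)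
qed

text \<open>Both sides applied to \<open>\<eta>\<close> are iterated integrals of \<open>f x * \<psi> (z - x) * \<eta> z\<close>, which has compact
support in \<open>(x, z)\<close> although \<open>f\<close> does not.\<close>

lemma dist_conv_test_fun_continuous:
  assumes f: "continuous_on UNIV f"
  shows "dist_conv (fun_dist f) (fun_dist (tf_apply \<psi>))
    = dist_reflect (fun_dist (correlation (fun_dist f) (tf_reflect \<psi>)))"
proof (rule dist_eqI)
  fix \<eta>
  let ?k = "\<lambda>x z. f x * tf_apply \<psi> (z - x) * tf_apply \<eta> z"
  obtain s where s: "0 < s" "tf_support \<eta> \<subseteq> {- s..s}"
    using compact_real_subset_interval[OF tf_compact] by blast
  obtain t where t: "0 < t" "tf_support \<psi> \<subseteq> {- t..t}"
    using compact_real_subset_interval[OF tf_compact] by blast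
  let ?S = "{- (s + t)..s + t} \<times> {- s..s}"
  have cont: "continuous_on UNIV (case_prod ?k)"
    unfolding case_prod_unfold
    by (intro continuous_intros continuous_on_compose2[OF f]
        continuous_on_compose2[OF smooth_imp_continuous_on[OF tf_smooth, of UNIV]]) auto
  have "compact ?S" by (intro compact_Times) auto
  then have "integrable lborel (\<lambda>p. indicator ?S p *\<^sub>R case_prod ?k p)"
    by (rule borel_integrable_compact) (rule continuous_on_subset[OF cont], simp)
  also have "(\<lambda>p. indicator ?S p *\<^sub>R case_prod ?k p) = case_prod ?k"
  proof
    fix p :: "real \<times> real"
    obtain x z where p: "p = (x, z)" by (cases p)
    have "?k x z = 0" if "p \<notin> ?S"
    proof (cases "z \<in> {- s..s}")
      case True
      then have "z - x \<notin> {- t..t}" using that p by auto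
      then show ?thesis using tf_zero_outside[OF t(2)] by simp
    qed (simp add: tf_zero_outside[OF s(2)])
    then show "indicator ?S p *\<^sub>R case_prod ?k p = case_prod ?k p"
      using p by (cases "p \<in> ?S") auto
  qed
  finally have int: "integrable (lborel \<Otimes>\<^sub>M lborel) (case_prod ?k)"
    by (simp add: lborel_prod)
  have conv: "tf_apply (tf_conv (fun_dist (tf_apply \<psi>)) \<eta>) x = (LINT z|lborel. tf_apply \<psi> (z - x) * tf_apply \<eta> z)"
    for x
  proof -
    have "tf_apply (tf_conv (fun_dist (tf_apply \<psi>)) \<eta>) x = (LINT y|lborel. tf_apply \<psi> y * tf_apply \<eta> (x + y))"
      by (simp add: tf_apply_tf_conv dist_compact_support_test_fun dist_apply_fun_dist
          tf_locally_integrable tf_shift.rep_eq)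
    also have "\<dots> = (LINT z|lborel. tf_apply \<psi> (z - x) * tf_apply \<eta> z)"
      by (subst lborel_integral_real_affine[of 1 _ "- x"]) simp_all
    finally show ?thesis .
  qed
  have "dist_apply (dist_conv (fun_dist f) (fun_dist (tf_apply \<psi>))) \<eta>
      = (LINT x|lborel. f x * (LINT z|lborel. tf_apply \<psi> (z - x) * tf_apply \<eta> z))"
    by (simp add: dist_apply_dist_conv dist_compact_support_test_fun dist_apply_fun_dist
        continuous_locally_integrable f conv)
  also have "\<dots> = (LINT x|lborel. LINT z|lborel. ?k x z)"
    by (simp only: integral_mult_right_zero[symmetric] mult.assoc)
  also have "\<dots> = (LINT z|lborel. LINT x|lborel. ?k x z)"
    by (rule lborel_pair.Fubini_integral[OF int, symmetric])
  also have "\<dots> = (LINT z|lborel. (LINT x|lborel. f x * tf_apply \<psi> (z - x)) * tf_apply \<eta> z)"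
    by simp
  also have "\<dots> = (LINT z|lborel. (LINT x|lborel. f x * tf_apply \<psi> (- z - x)) * tf_apply \<eta> (- z))"
    by (subst lborel_integral_real_affine[of "- 1" _ 0]) simp_all
  also have "\<dots> = dist_apply (dist_reflect (fun_dist (correlation (fun_dist f) (tf_reflect \<psi>)))) \<eta>"
    by (simp add: dist_reflect.rep_eq dist_apply_fun_dist locally_integrable_correlation correlation_def
        continuous_locally_integrable f tf_shift.rep_eq tf_reflect.rep_eq)
  finally show "dist_apply (dist_conv (fun_dist f) (fun_dist (tf_apply \<psi>))) \<eta>
      = dist_apply (dist_reflect (fun_dist (correlation (fun_dist f) (tf_reflect \<psi>)))) \<eta>" .
qed

text \<open>For derivatives of continuous functions the convolution with a test function is again a smooth
function: the operators commute with both descriptions, which reduces the claim to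
\<open>dist_conv_test_fun_continuous\<close>.\<close>

lemma dist_conv_test_fun_odo:
  assumes "\<And>c. c \<in> I \<Longrightarrow> continuous_on UNIV (f c)"
    and u: "u = (\<Sum>c\<in>I. odo (q c) (fun_dist (f c)))"
  shows "dist_conv u (fun_dist (tf_apply \<psi>)) = dist_reflect (fun_dist (correlation u (tf_reflect \<psi>)))"
proof -
  note T = dist_compact_support_test_fun[of \<psi>]
  let ?F = "\<lambda>u. fun_dist (correlation u (tf_reflect \<psi>))"
  have "dist_conv u (fun_dist (tf_apply \<psi>)) = (\<Sum>c\<in>I. odo (q c) (dist_reflect (?F (fun_dist (f c)))))"
    using assms(1) unfolding u
    by (simp add: linear_sum[OF dist_conv_linear_left[OF T]] dist_conv_odo_left[OF T] dist_conv_test_fun_continuous)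
  also have "\<dots> = (\<Sum>c\<in>I. dist_reflect (?F (odo (q c) (fun_dist (f c)))))"
  proof (rule sum.cong[OF refl])
    fix c
    show "odo (q c) (dist_reflect (?F (fun_dist (f c)))) = dist_reflect (?F (odo (q c) (fun_dist (f c))))"
      using dist_reflect_odo[of "odo_adjoint (q c)" "?F (fun_dist (f c))"]
      by (simp add: odo_correlation odo_adjoint_involutive)
  qed
  also have "\<dots> = dist_reflect (?F u)"
    unfolding u by (simp add: linear_sum[OF dist_reflect_linear] linear_sum[OF correlation_linear])
  finally show ?thesis .
qed

section \<open>The Green's matrix as a two-sided inverse\<close>

lemma mdo_apply_nth: "mdo_apply L f $ r = (\<Sum>d\<in>UNIV. odo (L $ r $ d) (f $ d))"
  by (simp add: mdo_apply_def)

lemma odo_det_null: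
  fixes L :: "'n::finite mdo"
  assumes "mdo_apply L q = 0"
  shows "odo (det L) (q $ d) = 0"
proof -
  obtain B :: "'n mdo" where B:
    "\<And>r c. (\<Sum>k\<in>UNIV. B $ r $ k * L $ k $ c) = (if r = c then det L else 0)"
    by (rule ex_left_adjugate[of L]) (rule that)
  have "0 = (\<Sum>k\<in>UNIV. odo (B $ d $ k) (mdo_apply L q $ k))"
    by (simp add: assms linear_0[OF odo_linear])
  also have "\<dots> = (\<Sum>k\<in>UNIV. \<Sum>c\<in>UNIV. odo (B $ d $ k * L $ k $ c) (q $ c))"
    by (simp add: mdo_apply_nth linear_sum[OF odo_linear] odo_mult)
  also have "\<dots> = (\<Sum>c\<in>UNIV. odo (\<Sum>k\<in>UNIV. B $ d $ k * L $ k $ c) (q $ c))"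
    by (subst sum.swap) (simp add: odo_sum)
  also have "\<dots> = (\<Sum>c\<in>UNIV. if c = d then odo (det L) (q $ c) else 0)"
    by (intro sum.cong) (auto simp: B odo_0)
  finally show ?thesis by simp
qed

lemma green_right_inverse:
  assumes "causal_green L G"
  shows "(\<Sum>d\<in>UNIV. odo (L $ r $ d) (G $ d $ c)) = (if r = c then dirac else 0)"
proof -
  have "mdo_apply_matrix L G $ r $ c = (if r = c then dirac else 0)"
    using assms by (simp add: causal_green_def)
  then show ?thesis by (simp add: mdo_apply_matrix_def mdo_apply_nth column_def)
qed

text \<open>The defect \<open>M\<close> between the two sides satisfies \<open>L M = L G L - L = 0\<close> and is causal. Multiplication
by the left adjugate turns this into the scalar equation \<open>det L M\<^sub>d = 0\<close>, whose only causal
solution is zero.\<close>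

lemma green_left_inverse:
  fixes L :: "'n::finite mdo"
  assumes L: "mdo_invertible L" and G: "causal_green L G"
  shows "(\<Sum>c\<in>UNIV. odo (L $ c $ r) (G $ d $ c)) = (if d = r then dirac else 0)"
proof -
  define M :: "distribution ^ 'n" where
    "M = (\<chi> d. (\<Sum>c\<in>UNIV. odo (L $ c $ r) (G $ d $ c)) - (if d = r then dirac else 0))"
  have "mdo_apply L M = 0"
  proof (simp add: vec_eq_iff, rule allI)
    fix s
    have "(\<Sum>d\<in>UNIV. odo (L $ s $ d) (\<Sum>c\<in>UNIV. odo (L $ c $ r) (G $ d $ c)))
        = (\<Sum>d\<in>UNIV. \<Sum>c\<in>UNIV. odo (L $ c $ r) (odo (L $ s $ d) (G $ d $ c)))"
    proof -
      have "odo (L $ s $ d) (odo (L $ c $ r) T) = odo (L $ c $ r) (odo (L $ s $ d) T)" for c d T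
        by (simp only: odo_mult[symmetric] mult.commute)
      then show ?thesis by (simp only: linear_sum[OF odo_linear])
    qed
    also have "\<dots> = (\<Sum>c\<in>UNIV. odo (L $ c $ r) (if s = c then dirac else 0))"
      by (subst sum.swap) (simp add: linear_sum[OF odo_linear, symmetric] green_right_inverse[OF G])
    also have "\<dots> = odo (L $ s $ r) dirac"
      by (simp add: if_distrib[of "odo _"] linear_0[OF odo_linear] cong: if_cong)
    finally have "(\<Sum>d\<in>UNIV. odo (L $ s $ d) (\<Sum>c\<in>UNIV. odo (L $ c $ r) (G $ d $ c))) = odo (L $ s $ r) dirac" .
    moreover have "(\<Sum>d\<in>UNIV. odo (L $ s $ d) (if d = r then dirac else 0)) = odo (L $ s $ r) dirac"
      by (simp add: if_distrib[of "odo _"] linear_0[OF odo_linear] cong: if_cong)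
    ultimately show "mdo_apply L M $ s = 0"
      by (simp add: mdo_apply_nth M_def linear_diff[OF odo_linear] sum_subtractf)
  qed
  then have null: "odo (det L) (M $ d) = 0" by (rule odo_det_null)
  have causal: "dist_supported_in (M $ d) {0..}"
    using G unfolding M_def causal_green_def
    by (auto intro!: dist_supported_in_diff dist_supported_in_sum dist_supported_in_odo
        dist_supported_in_dirac dist_supported_in_zero)
  have "M $ d = 0"
    using L causal_solution_unique[OF _ null causal] by (simp add: mdo_invertible_def)
  then show ?thesis by (simp add: M_def)
qed

text \<open>Transposition in the adjoint exchanges the order of the factors, so this needs \<open>G\<close> as a left
inverse of \<open>L\<close>.\<close>

lemma mdo_adjoint_green_conv:
  fixes L :: "'n::finite mdo"
  assumes L: "mdo_invertible L" and G: "causal_green L G"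
    and \<rho>: "\<And>i. dist_compact_support (\<rho> $ i)"
  shows "mdo_apply (mdo_adjoint L) (matrix_conv (green_adjoint G) \<rho>) = \<rho>"
proof (simp add: vec_eq_iff, rule allI)
  fix r
  have "mdo_apply (mdo_adjoint L) (matrix_conv (green_adjoint G) \<rho>) $ r
      = (\<Sum>c\<in>UNIV. \<Sum>d\<in>UNIV. dist_conv (dist_reflect (odo (L $ c $ r) (G $ d $ c))) (\<rho> $ d))"
    by (simp add: mdo_apply_nth mdo_adjoint_def matrix_conv_def green_adjoint_def linear_sum[OF odo_linear]
        dist_conv_odo_left[OF \<rho>] dist_reflect_odo)
  also have "\<dots> = (\<Sum>d\<in>UNIV. dist_conv (dist_reflect (\<Sum>c\<in>UNIV. odo (L $ c $ r) (G $ d $ c))) (\<rho> $ d))"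
    by (subst sum.swap) (simp add: linear_sum[OF dist_reflect_linear] linear_sum[OF dist_conv_linear_left[OF \<rho>]])
  also have "\<dots> = (\<Sum>d\<in>UNIV. if d = r then dist_conv dirac (\<rho> $ d) else 0)"
    by (intro sum.cong) (auto simp: green_left_inverse[OF L G] dist_reflect_dirac
        linear_0[OF dist_reflect_linear] linear_0[OF dist_conv_linear_left[OF \<rho>]])
  also have "\<dots> = dist_conv dirac (\<rho> $ r)" by simp
  also have "\<dots> = \<rho> $ r"
  proof (rule dist_eqI)
    fix \<phi>
    have "tf_shift 0 \<phi> = \<phi>" by (rule tf_eqI) (simp add: tf_shift.rep_eq)
    then show "dist_apply (dist_conv dirac (\<rho> $ r)) \<phi> = dist_apply (\<rho> $ r) \<phi>"
      by (simp add: dist_apply_dist_conv[OF \<rho>] dirac.rep_eq tf_apply_tf_conv[OF \<rho>])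
  qed
  finally show "mdo_apply (mdo_adjoint L) (matrix_conv (green_adjoint G) \<rho>) $ r = \<rho> $ r" .
qed

section \<open>Test functions that annihilate the null space\<close>

text \<open>Convolution with a point mass is translation, so that \<open>null_space_conv\<close> contains the translation
invariance of the null space.\<close>

lift_definition dirac_at :: "real \<Rightarrow> distribution" is "\<lambda>a \<phi>. tf_apply \<phi> a"
proof
  fix a :: real
  show "linear (\<lambda>\<phi>. tf_apply \<phi> a)" by (rule linearI) (auto simp: tf_rep_eqs)
  have "\<bar>tf_apply \<phi> a\<bar> \<le> 1 * (\<Sum>k\<le>0. tf_seminorm k \<phi>)" for \<phi>
    using tf_seminorm_upper[of 0 \<phi> a] by simp
  then show "tf_continuous (\<lambda>\<phi>. tf_apply \<phi> a)"
    unfolding tf_continuous_def by blast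
qed

lemma dist_compact_support_dirac_at: "dist_compact_support (dirac_at a)"
proof -
  have "dist_supported_in (dirac_at a) {a}"
    using tf_zero_outside[OF order_refl] by (force simp: dist_supported_in_def dirac_at.rep_eq)
  then show ?thesis unfolding dist_compact_support_def by (intro exI[of _ "{a}"]) simp
qed

lemma dist_conv_dirac_at: "dist_apply (dist_conv u (dirac_at a)) \<phi> = dist_apply u (tf_shift a \<phi>)"
proof -
  have "tf_conv (dirac_at a) \<phi> = tf_shift a \<phi>"
    by (rule tf_eqI) (simp add: tf_apply_tf_conv dist_compact_support_dirac_at dirac_at.rep_eq
        tf_shift.rep_eq add.commute)
  then show ?thesis by (simp add: dist_apply_dist_conv dist_compact_support_dirac_at)
qed

lemma null_space_conv:
  assumes "q \<in> null_space L" and T: "dist_compact_support T"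
  shows "(\<chi> i. dist_conv (q $ i) T) \<in> null_space L"
proof -
  have "mdo_apply L (\<chi> i. dist_conv (q $ i) T) $ r = dist_conv (mdo_apply L q $ r) T" for r
    by (simp add: mdo_apply_nth linear_sum[OF dist_conv_linear_left[OF T]] dist_conv_odo_left[OF T])
  then show ?thesis
    using assms(1) by (simp add: null_space_def vec_eq_iff linear_0[OF dist_conv_linear_left[OF T]])
qed

text \<open>With the right adjugate \<open>A\<close> and an anticausal fundamental solution \<open>g\<close> of \<open>det L\<close>, the matrix
\<open>A g\<close> is an anticausal Green's matrix. The columns of \<open>G - A g\<close> solve the homogeneous equation, so
\<open>G\<close> and \<open>A g\<close> give the same correlation with \<open>f\<close>; it vanishes on the right by causality of \<open>G\<close>
and on the left by anticausality of \<open>A g\<close>.\<close>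

lemma null_space_annihilator_in_adjoint_range:
  fixes L :: "'n::finite mdo"
  assumes L: "mdo_invertible L" and G: "causal_green L G"
    and f: "\<And>q. q \<in> null_space L \<Longrightarrow> vec_pairing q f = 0"
  obtains w where "mdo_apply (mdo_adjoint L) (vec_tf_dist w) = vec_tf_dist f"
proof -
  obtain g where g: "odo (det L) g = dirac" "dist_supported_in g {..0}"
    using L by (auto simp: mdo_invertible_def elim: ex_anticausal_fundamental_solution)
  obtain A :: "'n mdo" where A:
    "\<And>r c. (\<Sum>k\<in>UNIV. L $ r $ k * A $ k $ c) = (if r = c then det L else 0)"
    by (rule ex_right_adjugate[of L]) (rule that)
  define E where "E c = (\<chi> d. G $ d $ c - odo (A $ d $ c) g)" for c
  have E_null: "E c \<in> null_space L" for c
  proof (simp add: null_space_def vec_eq_iff, rule allI)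
    fix r
    have "(\<Sum>d\<in>UNIV. odo (L $ r $ d) (odo (A $ d $ c) g)) = (if r = c then dirac else 0)"
      by (simp add: odo_mult[symmetric] odo_sum[symmetric] A g(1) odo_0)
    then show "mdo_apply L (E c) $ r = 0"
      by (simp add: mdo_apply_nth E_def linear_diff[OF odo_linear] sum_subtractf green_right_inverse[OF G])
  qed
  define w where "w c x = (\<Sum>d\<in>UNIV. correlation (G $ d $ c) (f $ d) x)" for c x
  have w_left: "w c x = (\<Sum>d\<in>UNIV. correlation (odo (A $ d $ c) g) (f $ d) x)" for c x
  proof -
    have "0 = vec_pairing (\<chi> i. dist_conv (E c $ i) (dirac_at x)) f"
      using f null_space_conv[OF E_null dist_compact_support_dirac_at] by simp
    also have "\<dots> = w c x - (\<Sum>d\<in>UNIV. correlation (odo (A $ d $ c) g) (f $ d) x)"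
      by (simp add: vec_pairing_def dist_conv_dirac_at E_def dist_apply_diff sum_subtractf w_def correlation_def)
    finally show ?thesis by simp
  qed
  have "compact (\<Union>d. tf_support (f $ d))" using tf_compact by (intro compact_UN) auto
  then obtain s where s: "0 < s" "(\<Union>d. tf_support (f $ d)) \<subseteq> {- s..s}"
    by (rule compact_real_subset_interval)
  have supp: "tf_support (tf_shift x (f $ d)) \<subseteq> {- s - x..s - x}" for x d
    using s(2) by (intro tf_support_shift) blast
  have w_zero: "x \<in> {- s..s}" if "w c x \<noteq> 0" for c x
  proof (rule ccontr)
    assume "x \<notin> {- s..s}"
    then consider "s < x" | "x < - s" by fastforce
    then have "w c x = 0"
    proof cases
      case 1
      then have "tf_support (tf_shift x (f $ d)) \<inter> {0..} = {}" for d using supp[of x d] by fastforce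
      then show ?thesis
        using G unfolding w_def by (intro sum.neutral) (auto simp: causal_green_def dist_supported_in_def correlation_def)
    next
      case 2
      then have "tf_support (tf_shift x (f $ d)) \<inter> {..0} = {}" for d using supp[of x d] by fastforce
      then show ?thesis
        unfolding w_left using dist_supported_in_odo[OF g(2)]
        by (intro sum.neutral) (auto simp: dist_supported_in_def correlation_def)
    qed
    with that show False by contradiction
  qed
  define W :: "test_fun ^ 'n" where "W = (\<chi> c. Abs_test_fun (w c))"
  have "smooth (w c)" for c
    unfolding w_def[abs_def] by (intro smooth_sum smooth_correlation)
  moreover have "compact (fun_support (w c))" for c
    using w_zero[of c] by (rule compact_fun_supportI) auto
  ultimately have W: "tf_apply (W $ c) = w c" for c
    unfolding W_def by (simp add: Abs_test_fun_inverse)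
  have fun_w: "fun_dist (w c) = (\<Sum>d\<in>UNIV. fun_dist (correlation (G $ d $ c) (f $ d)))" for c
    unfolding w_def[abs_def]
    using fun_dist_sum[of UNIV "\<lambda>d. correlation (G $ d $ c) (f $ d)"] locally_integrable_correlation by blast
  have "mdo_apply (mdo_adjoint L) (vec_tf_dist W) $ r = vec_tf_dist f $ r" for r
  proof -
    have "mdo_apply (mdo_adjoint L) (vec_tf_dist W) $ r
        = (\<Sum>c\<in>UNIV. \<Sum>d\<in>UNIV. fun_dist (correlation (odo (L $ c $ r) (G $ d $ c)) (f $ d)))"
      by (simp add: mdo_apply_nth mdo_adjoint_def vec_tf_dist_def W fun_w linear_sum[OF odo_linear]
          odo_correlation odo_adjoint_involutive)
    also have "\<dots> = (\<Sum>d\<in>UNIV. fun_dist (correlation (\<Sum>c\<in>UNIV. odo (L $ c $ r) (G $ d $ c)) (f $ d)))"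
      by (subst sum.swap) (simp add: linear_sum[OF correlation_linear])
    also have "\<dots> = (\<Sum>d\<in>UNIV. if d = r then fun_dist (tf_apply (f $ d)) else 0)"
      by (intro sum.cong) (auto simp: green_left_inverse[OF L G] correlation_dirac linear_0[OF correlation_linear])
    finally show ?thesis by (simp add: vec_tf_dist_def)
  qed
  then show ?thesis by (intro that[of W]) (simp add: vec_eq_iff)
qed

lemma vec_pairing_linear_left: "linear (\<lambda>q. vec_pairing q f)"
  by (rule linearI) (simp_all add: vec_pairing_def dist_apply_arith sum.distrib sum_distrib_left)

lemma vec_pairing_linear_right: "linear (vec_pairing q)"
  by (rule linearI) (simp_all add: vec_pairing_def linear_add[OF dist_linear] linear_scale[OF dist_linear]
      sum.distrib sum_distrib_left)

lemma vec_tf_dist_linear: "linear vec_tf_dist"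
  by (rule linearI) (simp_all add: vec_eq_iff vec_tf_dist_def plus_test_fun.rep_eq scaleR_test_fun.rep_eq
      fun_dist_add(2) fun_dist_cmult(2) tf_locally_integrable)

lemma mdo_apply_linear: "linear (mdo_apply L)"
  by (rule linearI) (simp_all add: vec_eq_iff mdo_apply_nth linear_add[OF odo_linear] linear_scale[OF odo_linear]
      sum.distrib scaleR_sum_right)

text \<open>By biorthogonality, subtracting \<open>\<Sum> \<langle>p\<^sub>n, f\<rangle> \<phi>\<^sub>n\<close> leaves a test function orthogonal to the basis of
the null space.\<close>

lemma test_fun_decomposition:
  assumes L: "mdo_invertible L" and G: "causal_green L G" and adm: "admissible_system L N p \<phi>"
  obtains w a where "vec_tf_dist f = mdo_apply (mdo_adjoint L) (vec_tf_dist w) + (\<Sum>n = 1..N. a n *\<^sub>R vec_tf_dist (\<phi> n))"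
proof -
  define a where "a n = vec_pairing (p n) f" for n
  define h where "h = f - (\<Sum>n = 1..N. a n *\<^sub>R \<phi> n)"
  have span: "null_space L = span (p ` {1..N})" using adm by (simp add: admissible_system_def)
  have basis: "vec_pairing (p m) h = 0" if "m \<in> {1..N}" for m
  proof -
    have "vec_pairing (p m) h = a m - (\<Sum>n = 1..N. a n * vec_pairing (p m) (\<phi> n))"
      by (simp add: h_def a_def linear_diff[OF vec_pairing_linear_right] linear_sum[OF vec_pairing_linear_right]
          linear_scale[OF vec_pairing_linear_right])
    also have "(\<Sum>n = 1..N. a n * vec_pairing (p m) (\<phi> n)) = (\<Sum>n = 1..N. if n = m then a n else 0)"
      using adm that by (intro sum.cong) (auto simp: admissible_system_def)
    also have "\<dots> = a m" using that by simp
    finally show ?thesis by simp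
  qed
  have "vec_pairing q h = 0" if "q \<in> null_space L" for q
    by (rule linear_eq_0_on_span[OF vec_pairing_linear_left, where b = "p ` {1..N}"])
      (use basis that in \<open>auto simp: span\<close>)
  from null_space_annihilator_in_adjoint_range[OF L G this]
  obtain w where w: "mdo_apply (mdo_adjoint L) (vec_tf_dist w) = vec_tf_dist h"
    by blast
  show ?thesis
    by (rule that[of w a]) (simp add: w h_def linear_diff[OF vec_tf_dist_linear] linear_sum[OF vec_tf_dist_linear]
        linear_scale[OF vec_tf_dist_linear])
qed

section \<open>Decomposition of the distribution\<close>

lemma C0_if_zero_outside_compact:
  assumes "continuous_on UNIV v" "compact K" "\<And>x. x \<notin> K \<Longrightarrow> v x = 0"
  shows "v \<in> C0"
proof -
  obtain r where r: "0 < r" "K \<subseteq> {- r..r}" by (rule compact_real_subset_interval[OF assms(2)])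
  have "\<forall>\<^sub>F x in at_infinity. v x = 0"
    unfolding eventually_at_infinity
  proof (intro exI[of _ "r + 1"] allI impI assms(3))
    fix x :: real assume "r + 1 \<le> norm x"
    then show "x \<notin> K" using r(2) by (auto simp: abs_real_def split: if_splits)
  qed
  then have "(v \<longlongrightarrow> 0) at_infinity" by (rule tendsto_eventually)
  then show ?thesis using assms(1) by (simp add: C0_def)
qed

text \<open>The remainder \<open>v - v * \<psi> = v * Q T = (Q v) * T\<close> is a convolution of two compactly supported
distributions; continuity turns the support statement into pointwise vanishing.\<close>

lemma mollification_remainder_compactly_supported:
  assumes v: "continuous_on UNIV v" and T: "dist_compact_support T"
    and par: "odo Q T = dirac - fun_dist (tf_apply \<psi>)"
    and Qv: "dist_compact_support (odo Q (fun_dist v))"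
  obtains w K where "continuous_on UNIV w" "compact K" "\<And>x. x \<notin> K \<Longrightarrow> w x = 0"
    "fun_dist w = fun_dist v - dist_conv (fun_dist v) (fun_dist (tf_apply \<psi>))"
proof -
  let ?s = "\<lambda>x. correlation (fun_dist v) (tf_reflect \<psi>) (- x)"
  define w where "w x = v x - ?s x" for x
  have s: "continuous_on UNIV ?s"
    by (intro continuous_on_compose2[OF smooth_imp_continuous_on[OF smooth_correlation]] continuous_intros) auto
  have w: "continuous_on UNIV w"
    unfolding w_def by (intro continuous_intros v s)
  have eq: "fun_dist w = fun_dist v - dist_conv (fun_dist v) (fun_dist (tf_apply \<psi>))"
    unfolding w_def[abs_def] dist_conv_test_fun_continuous[OF v]
      dist_reflect_fun_dist[OF smooth_imp_continuous_on[OF smooth_correlation]]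
    by (rule fun_dist_diff) (intro continuous_locally_integrable v s)+
  have "dirac = odo Q T + fun_dist (tf_apply \<psi>)" using par by simp
  then have "fun_dist v = dist_conv (fun_dist v) (odo Q T) + dist_conv (fun_dist v) (fun_dist (tf_apply \<psi>))"
    using dist_conv_dirac[of "fun_dist v"]
    by (metis T dist_compact_support_odo dist_compact_support_test_fun dist_conv_add_right)
  then have "fun_dist w = dist_conv (fun_dist v) (odo Q T)"
    unfolding eq diff_eq_eq .
  also have "\<dots> = dist_conv (odo Q (fun_dist v)) T"
    by (simp add: dist_conv_odo_left[OF T] dist_conv_odo_right[OF T])
  finally have "fun_dist w = dist_conv (odo Q (fun_dist v)) T" .
  then have "dist_compact_support (fun_dist w)"
    using dist_compact_support_conv[OF Qv T] by simp
  then obtain K where K: "compact K" "dist_supported_in (fun_dist w) K"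
    unfolding dist_compact_support_def by blast
  show ?thesis
    by (rule that[OF w K(1) _ eq])
      (rule continuous_zero_if_fun_dist_supported[OF w K(2) compact_imp_closed[OF K(1)]])
qed

text \<open>Taking adjoints of \<open>L A = det L\<close> gives \<open>A\<^sup>* L\<^sup>* = (det L)\<^sup>*\<close>, so \<open>(det L)\<^sup>*\<close> maps every component of
\<open>v\<close> to a combination of derivatives of the components of \<open>\<rho>\<close>, which has compact support.\<close>

lemma compact_continuous_decomposition:
  fixes L :: "'n::finite mdo" and \<rho> :: "distribution ^ 'n"
  assumes L: "mdo_invertible L" and v: "continuous_on UNIV v"
    and \<rho>: "\<And>i. dist_compact_support (\<rho> $ i)"
    and Lv: "mdo_apply (mdo_adjoint L) (vec_fun_dist v) = \<rho>"
  obtains w f where "\<And>c. continuous_on UNIV (w c)" "\<And>c. \<exists>K. compact K \<and> (\<forall>x. x \<notin> K \<longrightarrow> w c x = 0)"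
    "\<rho> = mdo_apply (mdo_adjoint L) (\<chi> c. fun_dist (w c)) + vec_tf_dist f"
proof -
  let ?Q = "odo_adjoint (det L)"
  have "?Q \<noteq> 0" using L by (simp add: mdo_invertible_def odo_adjoint_eq_0_iff)
  then obtain T \<psi> where T: "dist_compact_support T" and par: "odo ?Q T = dirac - fun_dist (tf_apply \<psi>)"
    by (rule ex_parametrix)
  obtain A :: "'n mdo" where A:
    "\<And>r c. (\<Sum>k\<in>UNIV. L $ r $ k * A $ k $ c) = (if r = c then det L else 0)"
    by (rule ex_right_adjugate[of L]) (rule that)
  let ?v = "\<lambda>c x. v x $ c"
  have vc: "continuous_on UNIV (?v c)" for c by (intro continuous_intros v)
  have \<rho>_eq: "\<rho> $ r = (\<Sum>c\<in>UNIV. odo (odo_adjoint (L $ c $ r)) (fun_dist (?v c)))" for r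
    by (simp add: Lv[symmetric] mdo_apply_nth mdo_adjoint_def vec_fun_dist_def)
  have "odo ?Q (fun_dist (?v c)) = (\<Sum>r\<in>UNIV. odo (odo_adjoint (A $ r $ c)) (\<rho> $ r))" for c
  proof -
    have "(\<Sum>r\<in>UNIV. odo (odo_adjoint (A $ r $ c)) (\<rho> $ r))
        = (\<Sum>d\<in>UNIV. odo (odo_adjoint (\<Sum>r\<in>UNIV. L $ d $ r * A $ r $ c)) (fun_dist (?v d)))"
      unfolding \<rho>_eq linear_sum[OF odo_linear] odo_mult[symmetric] odo_adjoint_mult[symmetric]
      by (subst sum.swap) (simp add: odo_adjoint_sum odo_sum mult.commute)
    also have "\<dots> = (\<Sum>d\<in>UNIV. if d = c then odo ?Q (fun_dist (?v d)) else 0)"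
      by (intro sum.cong) (auto simp: A odo_adjoint_0 odo_0)
    finally show ?thesis by simp
  qed
  then have "dist_compact_support (odo ?Q (fun_dist (?v c)))" for c
    by (simp add: dist_compact_support_sum dist_compact_support_odo \<rho>)
  then have "\<exists>w. continuous_on UNIV w \<and> (\<exists>K. compact K \<and> (\<forall>x. x \<notin> K \<longrightarrow> w x = 0)) \<and>
      fun_dist w = fun_dist (?v c) - dist_conv (fun_dist (?v c)) (fun_dist (tf_apply \<psi>))" for c
    using mollification_remainder_compactly_supported[OF vc T par] by metis
  then obtain w where w: "\<And>c. continuous_on UNIV (w c)" "\<And>c. \<exists>K. compact K \<and> (\<forall>x. x \<notin> K \<longrightarrow> w c x = 0)"
    and w_eq: "\<And>c. fun_dist (w c) = fun_dist (?v c) - dist_conv (fun_dist (?v c)) (fun_dist (tf_apply \<psi>))"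
    by metis
  define f where "f = (\<chi> r. tf_reflect (tf_conv (\<rho> $ r) (tf_reflect \<psi>)))"
  \<comment> \<open>Every component of \<open>\<rho>\<close> is a sum of derivatives of continuous functions, so its convolution
  with \<open>\<psi>\<close> can be computed pointwise; \<open>f\<close> is a test function because \<open>\<rho>\<close> has compact support.\<close>
  have f: "fun_dist (tf_apply (f $ r)) = dist_conv (\<rho> $ r) (fun_dist (tf_apply \<psi>))" for r
  proof -
    have "tf_apply (f $ r) = (\<lambda>x. correlation (\<rho> $ r) (tf_reflect \<psi>) (- x))"
      by (simp add: f_def tf_reflect.rep_eq tf_apply_tf_conv[OF \<rho>] correlation_def)
    then show ?thesis
      by (simp add: dist_conv_test_fun_odo[OF vc \<rho>_eq]
          dist_reflect_fun_dist[OF smooth_imp_continuous_on[OF smooth_correlation]])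
  qed
  have "mdo_apply (mdo_adjoint L) (\<chi> c. fun_dist (w c)) $ r + vec_tf_dist f $ r = \<rho> $ r" for r
  proof -
    have "mdo_apply (mdo_adjoint L) (\<chi> c. fun_dist (w c)) $ r
        = \<rho> $ r - dist_conv (\<rho> $ r) (fun_dist (tf_apply \<psi>))"
      by (simp add: mdo_apply_nth mdo_adjoint_def w_eq linear_diff[OF odo_linear] sum_subtractf \<rho>_eq
          linear_sum[OF dist_conv_linear_left[OF dist_compact_support_test_fun]]
          dist_conv_odo_left[OF dist_compact_support_test_fun])
    then show ?thesis by (simp add: vec_tf_dist_def f)
  qed
  then show ?thesis by (intro that[of w f] w) (simp add: vec_eq_iff)
qed

theorem corollary1:
  fixes L :: "real poly ^ 'n::finite ^ 'n"
    and G :: "distribution ^ 'n ^ 'n"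
    and N :: nat
    and p :: "nat \<Rightarrow> distribution ^ 'n"
    and \<phi> :: "nat \<Rightarrow> test_fun ^ 'n"
    and \<rho> :: "distribution ^ 'n"
    and v :: "real \<Rightarrow> real ^ 'n"
  assumes "mdo_invertible L"
    and "causal_green L G"
    and "admissible_system L N p \<phi>"
    and "\<And>i. dist_compact_support (\<rho> $ i)"
    and "continuous_on UNIV v"
    and "matrix_conv (green_adjoint G) \<rho> = vec_fun_dist v"
  shows "\<rho> \<in> C_space L N \<phi>"
proof -
  have "mdo_apply (mdo_adjoint L) (vec_fun_dist v) = \<rho>"
    using mdo_adjoint_green_conv[OF assms(1,2,4)] assms(6) by simp
  then obtain w f where w: "\<And>c. continuous_on UNIV (w c)"
    and w_zero: "\<And>c. \<exists>K. compact K \<and> (\<forall>x. x \<notin> K \<longrightarrow> w c x = 0)"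
    and \<rho>: "\<rho> = mdo_apply (mdo_adjoint L) (\<chi> c. fun_dist (w c)) + vec_tf_dist f"
    using compact_continuous_decomposition[OF assms(1,5,4)] by metis
  obtain u a where f: "vec_tf_dist f = mdo_apply (mdo_adjoint L) (vec_tf_dist u) + (\<Sum>n = 1..N. a n *\<^sub>R vec_tf_dist (\<phi> n))"
    using test_fun_decomposition[OF assms(1-3)] by metis
  define z :: "real \<Rightarrow> real ^ 'n" where "z x = (\<chi> c. w c x + tf_apply (u $ c) x)" for x
  have u: "continuous_on UNIV (tf_apply (u $ c))" for c
    by (rule smooth_imp_continuous_on[OF tf_smooth])
  obtain K where K: "\<And>c. compact (K c)" "\<And>c x. x \<notin> K c \<Longrightarrow> w c x = 0"
    using w_zero by metis
  have "z \<in> C0"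
  proof (rule C0_if_zero_outside_compact)
    show "continuous_on UNIV z"
      unfolding z_def by (intro continuous_on_vec_lambda continuous_intros w u)
    show "compact (\<Union>c. K c \<union> tf_support (u $ c))"
      using K(1) tf_compact by (intro compact_UN compact_Un) auto
    show "z x = 0" if "x \<notin> (\<Union>c. K c \<union> tf_support (u $ c))" for x
      using that K(2) tf_zero_outside[OF order_refl] by (auto simp: z_def vec_eq_iff)
  qed
  moreover have "vec_fun_dist z = (\<chi> c. fun_dist (w c)) + vec_tf_dist u"
    using fun_dist_add(2)[OF continuous_locally_integrable[OF w] tf_locally_integrable]
    by (simp add: vec_eq_iff vec_fun_dist_def vec_tf_dist_def z_def)
  then have "\<rho> = mdo_apply (mdo_adjoint L) (vec_fun_dist z) + (\<Sum>n = 1..N. a n *\<^sub>R vec_tf_dist (\<phi> n))"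
    unfolding \<rho> f by (simp add: linear_add[OF mdo_apply_linear])
  ultimately show ?thesis
    unfolding C_space_def by blast
qed

end
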